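(* For every $\delta\in[0,1)$ and every $\alpha\in(\delta/3,1/3)$ there exists $\epsilon>0$ with the following property. For all constants $0<c_1\le c_2$ there are $C>0$ and $n_0$ such that for all $n\ge n_0$, setting $N=2n-2$, for every prime $p$ with $c_1N^\alpha\le p\le c_2N^\alpha$, every integer $\ell\le N+N^\delta$ and every $(\epsilon\log N)^{1/2}$-local function $f:\{0,1\}^\ell\to\{0,1\}^{N+1}$, $$\Delta\big(f(U),\,(Z,\mathrm{pmmajmod}_p(Z))\big)\ \ge\ \tfrac12-\tfrac{C}{\log N},$$ where $U$ is uniform on $\{0,1\}^\ell$ and $Z$ is uniform on $\{0,1\}^N$.
   Context: Binary tree $B_n$: vertices $v_0,\dots,v_{n-1}$ with root $v_0$; for $i\ge1$ the parent of $v_i$ is $v_{\lfloor (i-1)/2\rfloor}$ and $e_i$ is the edge joining $v_i$ to its parent. For $d\in\{0,1\}^{n-1}$ define $h(d)\in\{0,1\}^{n-1}$ by $h(d)_i=\bigoplus_{j:\,e_j\text{ lies on the path from }v_0\text{ to }v_i} d_j$. For an odd prime $p$ and integer $a$ let $\mathrm{MM}_p(a)=0$ if $(a\bmod p)\in\{0,\dots,(p-1)/2\}$ and $1$ otherwise (with $a\bmod p\in\{0,\dots,p-1\}$). For $z=(d,x)\in\{0,1\}^{n-1}\times\{0,1\}^{n-1}$ (first $n-1$ bits $d$, next $n-1$ bits $x$), $\mathrm{pmmajmod}_p(z)=\mathrm{MM}_p\big(\sum_{i=1}^{n-1}x_i(-1)^{h(d)_i}\big)\oplus\mathrm{parity}(x)$,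 where $\mathrm{parity}(x)=\sum_i x_i\bmod 2$. A function $f:\{0,1\}^\ell\to\{0,1\}^m$ is $d$-local if each output bit depends on at most $d$ input bits. $\Delta(D_1,D_2)=\max_{T}|\Pr[D_1\in T]-\Pr[D_2\in T]|$ is total variation distance. *)

theory Defs
  imports "HOL-Probability.Probability" "HOL-Computational_Algebra.Primes"
begin

text \<open>Bit strings in {0,1}^m are represented as bool lists of length m (True = 1).
  Index i of the paper (1-based) corresponds to list position i-1.\<close>

definition bitstrings :: "nat \<Rightarrow> bool list set" where
  "bitstrings m = {xs. length xs = m}"

text \<open>Edges of B_n on the path from the root v_0 to v_i: e_i, e_parent(i), ...
  (parent of v_j is v_((j-1) div 2)).\<close>
fun path_edges :: "nat \<Rightarrow> nat set" where
  "path_edges 0 = {}"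
| "path_edges (Suc i) = insert (Suc i) (path_edges (i div 2))"

definition hbit :: "(nat \<Rightarrow> bool) \<Rightarrow> nat \<Rightarrow> bool" where
  "hbit d i = odd (card {j \<in> path_edges i. d j})"

definition MM :: "nat \<Rightarrow> int \<Rightarrow> bool" where
  "MM p a = (\<not> (a mod int p \<le> (int p - 1) div 2))"

text \<open>z has length N = 2n-2; d_i = z!(i-1), x_i = z!(n-1+i-1) for i = 1..n-1.\<close>
definition pmmajmod :: "nat \<Rightarrow> nat \<Rightarrow> bool list \<Rightarrow> bool" where
  "pmmajmod p n z =
     (let d = (\<lambda>j. z ! (j - 1)); x = (\<lambda>i. z ! (n - 1 + i - 1)) in
      MM p (\<Sum>i\<in>{1..n-1}. (if x i then (if hbit d i then -1 else 1) else 0))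
      \<noteq> odd (card {i \<in> {1..n-1}. x i}))"

definition is_local :: "real \<Rightarrow> nat \<Rightarrow> nat \<Rightarrow> (bool list \<Rightarrow> bool list) \<Rightarrow> bool" where
  "is_local dd l m f \<longleftrightarrow>
     (\<forall>i<m. \<exists>S \<subseteq> {..<l}. real (card S) \<le> dd \<and>
        (\<forall>x y. length x = l \<longrightarrow> length y = l \<longrightarrow> (\<forall>j\<in>S. x ! j = y ! j) \<longrightarrow> f x ! i = f y ! i))"

definition tvd :: "'a pmf \<Rightarrow> 'a pmf \<Rightarrow> real" where
  "tvd D1 D2 = (SUP T. \<bar>measure_pmf.prob D1 T - measure_pmf.prob D2 T\<bar>)"

end

theory Submission
  imports Defs "HOL-Real_Asymp.Real_Asymp"
begin

text \<open>The map \<open>d \<mapsto> h(d)\<close> is a bijection, so the target is a uniform pair \<open>(h, x)\<close> together with a bit that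
  depends on \<open>x\<close> and the weights \<open>w\<^sub>j = x\<^sub>j (-1)\<^bsup>h\<^sub>j\<^esup>\<close>. Freezing the few inputs that influence the
  last output bit or some \<open>d\<^sub>j\<close> near the root makes every \<open>(h\<^sub>j, x\<^sub>j)\<close> a local function of the other
  inputs, since only a short bottom segment of the path to \<open>v\<^sub>j\<close> remains. A greedy choice yields
  almost linearly many inputs \<open>u\<close> that influence pairwise disjoint small blocks \<open>P u\<close> of indices.

  Fix all other inputs. If many of the chosen inputs are inert, the outputs lie in a set that is too
  small to be hit by the uniform distribution. If few blocks can be full, that is, have
  \<open>w\<^sub>j = 1\<close> throughout, then all outputs have few full blocks, which is again atypical for a uniform
  string. Otherwise many chosen inputs toggle a full block; as a full block has maximal weight, each
  of these changes \<open>\<Sum>w\<^sub>j\<close> by a nonzero amount less than \<open>p\<close>. By Fourier analysis modulo \<open>p\<close> (which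
  is odd, so that the parity twist does no harm) the required bit is then almost unbiased, whereas the
  last output bit is already fixed, hence it is wrong with probability close to one half.\<close>

section \<open>Characters modulo p\<close>

text \<open>The cubic Taylor remainder gives sin x \<ge> x - x^3/6, and x^2 \<le> 3 on this range.
  The endpoint 4/3 admits x = pi/p for every p \<ge> 3 through the crude bound pi < 4.\<close>

lemma half_le_sin:
  fixes x :: real
  assumes "0 \<le> x" "x \<le> 4 / 3"
  shows "x / 2 \<le> sin x"
proof -
  have "(\<Sum>m<3. sin_coeff m * x ^ m) = x"
    by (simp add: numeral_3_eq_3 sin_coeff_def)
  then have "\<bar>sin x - x\<bar> \<le> inverse (fact 3) * \<bar>x\<bar> ^ 3"
    using Maclaurin_sin_bound[of x 3] by simp
  then have "\<bar>sin x - x\<bar> \<le> x ^ 3 / 6"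
    using assms by (simp add: fact_numeral)
  then have "sin x \<ge> x - x ^ 3 / 6"
    by linarith
  moreover have "x * x\<^sup>2 \<le> x * 3"
  proof (rule mult_left_mono)
    have "x\<^sup>2 \<le> (4 / 3)\<^sup>2" using assms by (intro power_mono)
    then show "x\<^sup>2 \<le> 3" by (simp add: power2_eq_square)
  qed (use assms in simp)
  ultimately show ?thesis by (simp add: power3_eq_cube power2_eq_square)
qed

text \<open>Up to sign only the residue r of a matters. On 1..p-1 the value sin(pi r/p) is symmetric
  about pi/2 and smallest at the two ends, where it is at least pi/(2p).\<close>

lemma abs_sin_rational_ge:
  fixes p :: nat and a :: int
  assumes "p \<ge> 3" "\<not> int p dvd a"
  shows "1 / real p \<le> \<bar>sin (pi * of_int a / real p)\<bar>"
proof -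
  define r where "r = a mod int p"
  have r: "1 \<le> r" "r \<le> int p - 1"
    using assms pos_mod_bound[of "int p" a] pos_mod_sign[of "int p" a]
    unfolding r_def dvd_eq_mod_eq_0 by linarith+
  have sin_ge: "1 / real p \<le> sin x" if "pi / real p \<le> x" "x \<le> pi / 2" for x
  proof -
    have "pi / real p \<le> 4 / 3"
      using assms(1) pi_less_4 by (simp add: field_simps)
    then have "pi / real p / 2 \<le> sin (pi / real p)"
      by (intro half_le_sin) auto
    moreover have "1 / real p \<le> pi / real p / 2"
      using assms(1) pi_ge_two by (simp add: field_simps)
    moreover have "sin (pi / real p) \<le> sin x"
      using that by (intro sin_monotone_2pi_le)
        (use pi_ge_zero assms in \<open>auto intro: order_trans[of _ 0]\<close>)
    ultimately show ?thesis by linarith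
  qed
  let ?x = "pi * of_int r / real p"
  have lo: "pi / real p \<le> ?x"
    using r(1) by (intro divide_right_mono) auto
  have "1 / real p \<le> sin ?x"
  proof (cases "?x \<le> pi / 2")
    case True
    then show ?thesis using lo sin_ge by blast
  next
    case False
    have "of_int r \<le> real p - 1"
      using r(2) by linarith
    then have "pi * of_int r \<le> pi * (real p - 1)" by (intro mult_left_mono) auto
    then have "pi / real p \<le> pi - ?x"
      using assms(1) by (simp add: field_simps)
    then have "1 / real p \<le> sin (pi - ?x)" using False by (intro sin_ge) auto
    then show ?thesis by simp
  qed
  moreover have "\<bar>sin (pi * of_int a / real p)\<bar> = \<bar>sin ?x\<bar>"
  proof -
    have "a = int p * (a div int p) + r" by (simp add: r_def)
    then have "real_of_int a = real p * of_int (a div int p) + of_int r"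
      by (metis of_int_add of_int_mult of_int_of_nat_eq)
    then have "pi * of_int a / real p = pi * of_int (a div int p) + ?x"
      using assms(1) by (simp add: field_simps)
    then have *: "sin (pi * of_int a / real p)
      = cos (pi * of_int (a div int p)) * sin ?x"
      by (simp add: sin_add sin_npi_int)
    have "\<bar>cos (pi * of_int (a div int p))\<bar> = (1::real)"
      using sin_cos_squared_add[of "pi * of_int (a div int p)"]
      by (simp add: power2_eq_1_iff abs_if)
    then show ?thesis unfolding * by (simp add: abs_mult)
  qed
  ultimately show ?thesis by linarith
qed

text \<open>This is the contraction gained from one active input. The squared norm is 2 + 2 \<sigma>
  cos t, so cos t has to stay away from both 1 and -1, that is, sin t away from 0. Because p is odd,
  p does not divide 2a either, which excludes both signs at once.\<close>

lemma norm_one_plus_cis_le: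
  fixes p :: nat and a :: int and \<sigma> :: complex
  assumes p: "prime p" "p \<ge> 3" and a: "\<not> int p dvd a" and \<sigma>: "\<sigma> = 1 \<or> \<sigma> = -1"
  shows "cmod (1 + \<sigma> * cis (2 * pi * of_int a / real p)) \<le> 2 * exp (- 1 / (8 * (real p)\<^sup>2))"
proof -
  let ?t = "2 * pi * of_int a / real p"
  have "\<not> int p dvd 2"
    using p(2) by (auto dest: zdvd_imp_le)
  then have "\<not> int p dvd 2 * a"
    using a p(1) by (simp add: prime_dvd_mult_iff)
  then have "1 / real p \<le> \<bar>sin (pi * of_int (2 * a) / real p)\<bar>"
    by (intro abs_sin_rational_ge p)
  then have "(1 / real p)\<^sup>2 \<le> \<bar>sin ?t\<bar>\<^sup>2"
    by (intro power_mono) (auto simp: mult_ac)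
  then have s: "1 / (real p)\<^sup>2 \<le> (sin ?t)\<^sup>2" by (simp add: power_divide)
  then have c: "(cos ?t)\<^sup>2 \<le> 1 - 1 / (real p)\<^sup>2"
    using sin_cos_squared_add[of ?t] by linarith
  have p2: "1 / (real p)\<^sup>2 \<le> 1"
    using p(2) by (simp add: field_simps)
  have "\<bar>cos ?t\<bar> \<le> 1 - 1 / (2 * (real p)\<^sup>2)"
  proof (rule power2_le_imp_le)
    have "(1 - 1 / (2 * (real p)\<^sup>2))\<^sup>2 = 1 - 1 / (real p)\<^sup>2 + (1 / (2 * (real p)\<^sup>2))\<^sup>2"
      by (simp add: power2_diff)
    moreover have "0 \<le> (1 / (2 * (real p)\<^sup>2))\<^sup>2" by simp
    ultimately show "\<bar>cos ?t\<bar>\<^sup>2 \<le> (1 - 1 / (2 * (real p)\<^sup>2))\<^sup>2"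
      using c unfolding power2_abs by linarith
  qed (use p2 in simp)
  moreover have "(cmod (1 + \<sigma> * cis ?t))\<^sup>2 \<le> 2 + 2 * \<bar>cos ?t\<bar>"
    using \<sigma> sin_cos_squared_add[of ?t] unfolding cmod_power2
    by (elim disjE) (auto simp: power2_eq_square algebra_simps)
  ultimately have "(cmod (1 + \<sigma> * cis ?t))\<^sup>2 \<le> 4 * (1 + - 1 / (4 * (real p)\<^sup>2))"
    by (simp add: field_simps)
  also have "\<dots> \<le> 4 * exp (- 1 / (4 * (real p)\<^sup>2))"
    by (intro mult_left_mono exp_ge_add_one_self) simp
  also have "\<dots> = (2 * exp (- 1 / (8 * (real p)\<^sup>2)))\<^sup>2"
    by (simp add: power_mult_distrib flip: exp_double)
  finally show ?thesis
    by (rule power2_le_imp_le) simp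
qed

lemma sum_cis_roots_of_unity:
  fixes p :: nat and a :: int
  assumes "p > 0"
  shows "(\<Sum>k<p. cis (2 * pi * real k * of_int a / real p))
    = (if int p dvd a then of_nat p else 0)"
proof -
  define z where "z = cis (2 * pi * of_int a / real p)"
  have pow: "cis (2 * pi * real k * of_int a / real p) = z ^ k" for k
    unfolding z_def by (simp add: Complex.DeMoivre mult_ac)
  show ?thesis
  proof (cases "int p dvd a")
    case True
    then obtain b where "a = int p * b" by (elim dvdE)
    then have "2 * pi * of_int a / real p = 2 * pi * of_int b"
      using assms by simp
    then have "z = 1" using cis_multiple_2pi[of "of_int b"] by (simp only: z_def Ints_of_int)
    then show ?thesis using True by (simp add: pow)
  next
    case False
    have "z ^ p = cis (2 * pi * of_int a)"
      using assms by (simp add: z_def Complex.DeMoivre)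
    then have zp: "z ^ p = 1" using cis_multiple_2pi[of "of_int a"] by simp
    have "z \<noteq> 1"
    proof
      assume "z = 1"
      then have "cos (2 * pi * of_int a / real p) = 1"
        unfolding z_def by (metis cis.simps(1) one_complex.simps(1))
      then obtain b :: int where "2 * pi * of_int a / real p = of_int b * 2 * pi"
        by (auto simp: cos_one_2pi_int)
      then have "of_int a = real p * of_int b"
        using assms by (simp add: field_simps)
      then have "a = int p * b"
        by (metis of_int_eq_iff of_int_mult of_int_of_nat_eq)
      with False show False by simp
    qed
    then show ?thesis using False zp by (simp add: pow geometric_sum)
  qed
qed

lemma cis_sum:
  "finite A \<Longrightarrow> cis (\<Sum>x\<in>A. g x) = (\<Prod>x\<in>A. cis (g x))"
  by (induction A rule: finite_induct) (auto simp flip: cis_mult)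

text \<open>Writing bits as signs turns exclusive or into multiplication and the bias of a bit into
  a sum.\<close>

definition bsign :: "bool \<Rightarrow> complex" where
  "bsign b = (if b then -1 else 1)"

lemma norm_bsign [simp]: "cmod (bsign b) = 1"
  by (simp add: bsign_def)

lemma MM_mod: "MM p (s mod int p) = MM p s"
  by (simp add: MM_def)

text \<open>An odd p = 2q + 1 leaves q + 1 residues with value 0 and q with value 1. This surplus of
  one is the zeroth Fourier coefficient before normalisation.\<close>

lemma sum_bsign_MM:
  assumes "odd p"
  shows "(\<Sum>r<p. bsign (MM p (int r))) = 1"
proof -
  obtain q where q: "p = 2 * q + 1" using assms by (elim oddE)
  have "(\<Sum>r<p. bsign (MM p (int r))) = (\<Sum>r<p. if r \<le> q then 1 else - 1)"
    by (intro sum.cong) (auto simp: bsign_def MM_def q)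
  also have "\<dots> = of_nat (card {r\<in>{..<p}. r \<le> q}) - of_nat (card {r\<in>{..<p}. \<not> r \<le> q})"
    by (simp add: sum.If_cases Int_def)
  also have "{r\<in>{..<p}. r \<le> q} = {..q}" using q by auto
  also have "{r\<in>{..<p}. \<not> r \<le> q} = {q<..<p}" by auto
  finally show ?thesis by (simp add: q)
qed

text \<open>Fourier inversion on the integers modulo p. Only two facts about the coefficients are
  kept: the mean is 1/p, and all are trivially at most 1, which suffices because the other
  frequencies are later damped exponentially.\<close>

lemma bsign_MM_fourier:
  assumes p: "odd p"
  obtains c :: "nat \<Rightarrow> complex"
  where "\<And>s. bsign (MM p s) = (\<Sum>\<xi><p. c \<xi> * cis (2 * pi * real \<xi> * of_int s / real p))"
    and "cmod (c 0) = 1 / real p" and "\<And>\<xi>. cmod (c \<xi>) \<le> 1"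
proof -
  define c where "c \<xi> = (\<Sum>r<p. bsign (MM p (int r)) *
     cis (- 2 * pi * real \<xi> * real r / real p)) / of_nat p" for \<xi>
  have p0: "p > 0" using p by (cases p) auto
  have "bsign (MM p s) = (\<Sum>\<xi><p. c \<xi> * cis (2 * pi * real \<xi> * of_int s / real p))" for s
  proof -
    define r0 where "r0 = nat (s mod int p)"
    have r0: "r0 < p" "int r0 = s mod int p"
      using p0 by (auto simp: r0_def nat_less_iff)
    have dvd: "int p dvd s - int r \<longleftrightarrow> r = r0" if "r < p" for r
    proof -
      have "int p dvd s - int r \<longleftrightarrow> s mod int p = int r mod int p"
        by (simp add: mod_eq_dvd_iff)
      also have "\<dots> \<longleftrightarrow> r = r0" using that r0 by auto
      finally show ?thesis .
    qed
    have "(\<Sum>\<xi><p. c \<xi> * cis (2 * pi * real \<xi> * of_int s / real p))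
      = (\<Sum>\<xi><p. \<Sum>r<p. bsign (MM p (int r)) / of_nat p *
          cis (2 * pi * real \<xi> * of_int (s - int r) / real p))"
      unfolding c_def sum_divide_distrib sum_distrib_right
      by (intro sum.cong refl) (simp add: cis_mult algebra_simps diff_divide_distrib)
    also have "\<dots> = (\<Sum>r<p. bsign (MM p (int r)) / of_nat p *
          (\<Sum>\<xi><p. cis (2 * pi * real \<xi> * of_int (s - int r) / real p)))"
      by (subst sum.swap) (simp add: sum_distrib_left)
    also have "\<dots> = (\<Sum>r<p. if r = r0 then bsign (MM p (int r)) else 0)"
      using p0 dvd by (intro sum.cong refl) (auto simp only: sum_cis_roots_of_unity, auto)
    also have "\<dots> = bsign (MM p s)"
      using r0 by (simp add: MM_mod)
    finally show ?thesis ..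
  qed
  moreover have "cmod (c 0) = 1 / real p"
    using sum_bsign_MM[OF p] by (simp add: c_def norm_divide)
  moreover have "cmod (c \<xi>) \<le> 1" for \<xi>
  proof -
    have "cmod (\<Sum>r<p. bsign (MM p (int r)) * cis (- 2 * pi * real \<xi> * real r / real p))
      \<le> (\<Sum>r<p. 1)"
      by (intro sum_norm_le) (simp add: norm_mult)
    then show ?thesis using p0 by (simp add: c_def norm_divide field_simps)
  qed
  ultimately show ?thesis using that by blast
qed

section \<open>Disjoint blocks in random sets\<close>

lemma sum_Pow_split:
  assumes "finite L" "I \<subseteq> L"
  shows "(\<Sum>A\<in>Pow L. g A) = (\<Sum>Y\<in>Pow (L - I). \<Sum>X\<in>Pow I. g (Y \<union> X))"
proof -
  have fin: "finite I" "finite (L - I)" using assms finite_subset by auto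
  have "(\<Sum>A\<in>Pow L. g A) = (\<Sum>(Y, X)\<in>Pow (L - I) \<times> Pow I. g (Y \<union> X))"
    using assms(2)
    by (intro sum.reindex_bij_witness[of _ "\<lambda>(Y, X). Y \<union> X" "\<lambda>A. (A - I, A \<inter> I)"])
      (auto simp: Un_Diff_Int)
  then show ?thesis using fin by (simp add: sum.cartesian_product)
qed

lemma card_Pow_split:
  assumes "finite L" "I \<subseteq> L"
  shows "card {A\<in>Pow L. Q A} = (\<Sum>Y\<in>Pow (L - I). card {X\<in>Pow I. Q (Y \<union> X)})"
proof -
  have card: "card {x\<in>S. R x} = (\<Sum>x\<in>S. if R x then 1 else 0)"
    if "finite S" for S :: "'b set" and R
    using that by (simp add: sum.If_cases Int_def)
  have fin: "finite (Pow I)" using assms finite_subset by auto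
  show ?thesis
    using assms(1) fin by (simp only: card finite_Pow_iff sum_Pow_split[OF assms])
qed

lemma sum_Pow_prod:
  fixes g1 g0 :: "'a \<Rightarrow> 'c :: comm_semiring_1"
  assumes "finite I"
  shows "(\<Sum>X\<in>Pow I. \<Prod>u\<in>I. if u \<in> X then g1 u else g0 u) = (\<Prod>u\<in>I. g1 u + g0 u)"
proof -
  have "(\<Prod>u\<in>I. if u \<in> X then g1 u else g0 u) = prod g1 X * prod g0 (I - X)"
    if "X \<in> Pow I" for X
  proof -
    have "I \<inter> X = X" "I \<inter> - X = I - X" using that by auto
    then show ?thesis using assms by (simp add: prod.If_cases)
  qed
  then show ?thesis using assms by (simp add: prod_add)
qed

text \<open>Containment of disjoint blocks in a uniformly random set is independent, so the
  expectation of the product factors. A block is contained with probability 2^(-card), which lowers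
  its factor from 1 by half that amount.\<close>

lemma sum_Pow_disjoint_blocks:
  fixes \<Omega> :: "'a set" and Q :: "'b \<Rightarrow> 'a set"
  assumes "finite I" "finite \<Omega>" "\<And>u. u \<in> I \<Longrightarrow> Q u \<subseteq> \<Omega>"
    and "\<And>u v. u \<in> I \<Longrightarrow> v \<in> I \<Longrightarrow> u \<noteq> v \<Longrightarrow> Q u \<inter> Q v = {}"
  shows "(\<Sum>Z\<in>Pow \<Omega>. \<Prod>u\<in>I. if Q u \<subseteq> Z then 1 / 2 else 1)
    = 2 ^ card \<Omega> * (\<Prod>u\<in>I. 1 - 1 / (2 * 2 ^ card (Q u)) :: real)"
  using assms
proof (induction I arbitrary: \<Omega> rule: finite_induct)
  case empty
  then show ?case by (simp add: card_Pow)
next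
  case (insert v I)
  let ?g = "\<lambda>u Z. if Q u \<subseteq> Z then 1 / 2 else 1 :: real"
  have Qv: "Q v \<subseteq> \<Omega>" "finite (Q v)"
    using insert.prems(1,2) finite_subset[of "Q v" \<Omega>] by auto
  have IH: "(\<Sum>Z\<in>Pow (\<Omega> - Q v). \<Prod>u\<in>I. ?g u Z)
    = 2 ^ card (\<Omega> - Q v) * (\<Prod>u\<in>I. 1 - 1 / (2 * 2 ^ card (Q u)))"
  proof (rule insert.IH)
    show "Q u \<subseteq> \<Omega> - Q v" if "u \<in> I" for u
      using insert.prems(2)[of u] insert.prems(3)[of u v] insert.hyps(2) that by auto
  qed (use insert.prems in auto)
  have "(\<Sum>Z\<in>Pow \<Omega>. \<Prod>u\<in>insert v I. ?g u Z)
    = (\<Sum>Y\<in>Pow (\<Omega> - Q v). \<Sum>X\<in>Pow (Q v). \<Prod>u\<in>insert v I. ?g u (Y \<union> X))"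
    by (rule sum_Pow_split) (use insert.prems Qv in auto)
  also have "\<dots> = (\<Sum>Y\<in>Pow (\<Omega> - Q v). \<Sum>X\<in>Pow (Q v). ?g v X * (\<Prod>u\<in>I. ?g u Y))"
  proof (intro sum.cong refl)
    fix Y X assume YX: "Y \<in> Pow (\<Omega> - Q v)" "X \<in> Pow (Q v)"
    have "?g v (Y \<union> X) = ?g v X" using YX by (intro if_cong) auto
    moreover have "?g u (Y \<union> X) = ?g u Y" if "u \<in> I" for u
    proof -
      have "Q u \<inter> Q v = {}"
        using insert.prems(3)[of u v] insert.hyps(2) that by auto
      then have "(Q u \<subseteq> Y \<union> X) = (Q u \<subseteq> Y)" using YX by auto
      then show ?thesis by simp
    qed
    ultimately show "(\<Prod>u\<in>insert v I. ?g u (Y \<union> X)) = ?g v X * (\<Prod>u\<in>I. ?g u Y)"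
      using insert.hyps by (simp cong: prod.cong)
  qed
  also have "\<dots> = (\<Sum>X\<in>Pow (Q v). ?g v X) * (\<Sum>Y\<in>Pow (\<Omega> - Q v). \<Prod>u\<in>I. ?g u Y)"
    by (simp only: sum_distrib_left sum_distrib_right)
  \<comment> \<open>Exactly one subset of \<open>Q v\<close> contains the whole block, so the sum
    falls short of the number of subsets by 1/2.\<close>
  also have "(\<Sum>X\<in>Pow (Q v). ?g v X) = (\<Sum>X\<in>Pow (Q v). 1 - (if X = Q v then 1 / 2 else 0))"
    by (intro sum.cong refl) auto
  also have "\<dots> = 2 ^ card (Q v) * (1 - 1 / (2 * 2 ^ card (Q v)))"
    using Qv(2) by (simp add: sum_subtractf sum.delta card_Pow right_diff_distrib)
  also have "2 ^ card (Q v) * (1 - 1 / (2 * 2 ^ card (Q v))) * (\<Sum>Y\<in>Pow (\<Omega> - Q v). \<Prod>u\<in>I. ?g u Y)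
    = 2 ^ (card (Q v) + card (\<Omega> - Q v)) * (\<Prod>u\<in>insert v I. 1 - 1 / (2 * 2 ^ card (Q u)))"
    using insert.hyps by (simp add: IH power_add)
  also have "card (Q v) + card (\<Omega> - Q v) = card \<Omega>"
    using Qv insert.prems(1) by (metis card_Diff_subset card_mono le_add_diff_inverse)
  finally show ?case .
qed

text \<open>Markov's inequality for \<open>2 powr (- X)\<close>, where \<open>X\<close> counts the blocks contained in a uniformly
  random set.\<close>

lemma card_few_blocks_le:
  fixes \<Omega> :: "'a set" and Q :: "'b \<Rightarrow> 'a set"
  assumes "finite I" "finite \<Omega>" "\<And>u. u \<in> I \<Longrightarrow> Q u \<subseteq> \<Omega>"
    and "\<And>u v. u \<in> I \<Longrightarrow> v \<in> I \<Longrightarrow> u \<noteq> v \<Longrightarrow> Q u \<inter> Q v = {}"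
    and E: "\<And>u. u \<in> I \<Longrightarrow> card (Q u) \<le> E"
  shows "real (card {Z\<in>Pow \<Omega>. card {u\<in>I. Q u \<subseteq> Z} < r})
    \<le> 2 ^ card \<Omega> * 2 ^ r * exp (- real (card I) / (2 * 2 ^ E))"
proof -
  let ?T = "{Z\<in>Pow \<Omega>. card {u\<in>I. Q u \<subseteq> Z} < r}"
  let ?g = "\<lambda>Z. \<Prod>u\<in>I. if Q u \<subseteq> Z then 1 / 2 else 1 :: real"
  have g: "?g Z = (1 / 2) ^ card {u\<in>I. Q u \<subseteq> Z}" for Z
    using assms(1) by (simp add: prod.If_cases Int_def)
  \<comment> \<open>Every set in \<open>?T\<close> contains fewer than r blocks, so its product of
    weights is at least 2^(-r).\<close>
  have "real (card ?T) * (1 / 2) ^ r = (\<Sum>Z\<in>?T. (1 / 2) ^ r)" by simp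
  also have "\<dots> \<le> (\<Sum>Z\<in>?T. ?g Z)"
    unfolding g by (intro sum_mono power_decreasing) auto
  also have "\<dots> \<le> (\<Sum>Z\<in>Pow \<Omega>. ?g Z)"
    by (intro sum_mono2) (use assms(2) in \<open>auto intro!: prod_nonneg\<close>)
  also have "\<dots> = 2 ^ card \<Omega> * (\<Prod>u\<in>I. 1 - 1 / (2 * 2 ^ card (Q u)))"
    by (rule sum_Pow_disjoint_blocks) (use assms in auto)
  also have "\<dots> \<le> 2 ^ card \<Omega> * (\<Prod>u\<in>I. exp (- 1 / (2 * 2 ^ E)))"
  proof (intro mult_left_mono prod_mono conjI)
    fix u assume u: "u \<in> I"
    have "(2::real) ^ card (Q u) \<le> 2 ^ E"
      using E[OF u] by (intro power_increasing) auto
    then have "1 / (2 * 2 ^ E) \<le> 1 / (2 * 2 ^ card (Q u) :: real)"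
      by (intro divide_left_mono) auto
    then have "1 - 1 / (2 * 2 ^ card (Q u)) \<le> 1 + - 1 / (2 * 2 ^ E :: real)" by simp
    also have "\<dots> \<le> exp (- 1 / (2 * 2 ^ E))" by (rule exp_ge_add_one_self)
    finally show "1 - 1 / (2 * 2 ^ card (Q u)) \<le> exp (- 1 / (2 * 2 ^ E :: real))" .
    have "(1::real) \<le> 2 * 2 ^ card (Q u)"
      using one_le_power[of "2::real" "card (Q u)"] by linarith
    then show "0 \<le> 1 - 1 / (2 * 2 ^ card (Q u) :: real)" by simp
  qed simp
  also have "(\<Prod>u\<in>I. exp (- 1 / (2 * 2 ^ E))) = exp (- real (card I) / (2 * 2 ^ E))"
    by (simp flip: exp_of_nat_mult)
  finally show ?thesis by (simp add: power_one_over field_simps)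
qed

text \<open>Double counting the pairs (u, j) with u in \<open>V j\<close> shows that at most half of
  card J elements have degree above 2D. Among the others a maximal family with disjoint
  neighbourhoods \<open>P u\<close> is chosen. Each member blocks at most itself and the 2D sets
  \<open>V j\<close> of size D that contain it, hence the factor 2D^2 + 1.\<close>

lemma independent_vertices_exist:
  fixes V :: "'j \<Rightarrow> 'a set"
  assumes J: "finite J" and L: "finite L" and D: "D > 0"
    and V: "\<And>j. j \<in> J \<Longrightarrow> finite (V j) \<and> card (V j) \<le> D"
  obtains I where "I \<subseteq> L" "\<And>u. u \<in> I \<Longrightarrow> card {j\<in>J. u \<in> V j} \<le> 2 * D"
    and "\<And>u v j. u \<in> I \<Longrightarrow> v \<in> I \<Longrightarrow> j \<in> J \<Longrightarrow> u \<in> V j \<Longrightarrow> v \<in> V j \<Longrightarrow> u = v"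
    and "2 * card L \<le> card J + 2 * (card I * (2 * D\<^sup>2 + 1))"
proof -
  define P where "P u = {j\<in>J. u \<in> V j}" for u
  have finP: "finite (P u)" for u using J by (simp add: P_def)
  define H where "H = {u\<in>L. card (P u) > 2 * D}"
  define C where "C = {u\<in>L. card (P u) \<le> 2 * D}"
  have fin: "finite H" "finite C" using L by (auto simp: H_def C_def)
  have "of_nat (card H) * (2 * D) \<le> (\<Sum>u\<in>H. card (P u))"
    by (rule sum_bounded_below) (simp add: H_def)
  also have "\<dots> = (\<Sum>j\<in>J. card {u\<in>H. u \<in> V j})"
    unfolding P_def by (rule sum_multicount_gen[OF fin(1) J]) simp
  also have "\<dots> \<le> (\<Sum>j\<in>J. D)"
  proof (rule sum_mono)
    fix j assume "j \<in> J"
    then have "card {u\<in>H. u \<in> V j} \<le> card (V j)" "card (V j) \<le> D"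
      using V[of j] by (auto intro: card_mono)
    then show "card {u\<in>H. u \<in> V j} \<le> D" by linarith
  qed
  finally have "D * (2 * card H) \<le> D * card J" by (simp add: mult_ac)
  then have H: "2 * card H \<le> card J" using D by simp
  have LHC: "card L = card H + card C"
  proof -
    have "L = H \<union> C" "H \<inter> C = {}" by (auto simp: H_def C_def)
    then show ?thesis using fin by (simp add: card_Un_disjoint)
  qed
  define ok where "ok I \<longleftrightarrow> (\<forall>u\<in>I. \<forall>v\<in>I. u \<noteq> v \<longrightarrow> P u \<inter> P v = {})" for I
  have ok_fin: "finite {I\<in>Pow C. ok I}" and ok_ne: "{I\<in>Pow C. ok I} \<noteq> {}"
    using fin by (auto simp: ok_def)
  obtain I where "I \<in> {I\<in>Pow C. ok I}"
    and I_max: "\<forall>I'\<in>{I\<in>Pow C. ok I}. I \<subseteq> I' \<longrightarrow> I = I'"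
    by (rule bexE[OF finite_has_maximal[OF ok_fin ok_ne]])
  then have I: "I \<subseteq> C" "ok I" by auto
  have max: "I' = I" if "I' \<subseteq> C" "ok I'" "I \<subseteq> I'" for I'
    using I_max that by blast
  have finI: "finite I" using I fin finite_subset by auto
  \<comment> \<open>By maximality an unchosen v shares an index j with some chosen u, so v lies in
    one of the sets \<open>V j\<close> that contain u.\<close>
  have "C \<subseteq> (\<Union>u\<in>I. insert u (\<Union>j\<in>P u. V j))"
  proof
    fix v assume v: "v \<in> C"
    show "v \<in> (\<Union>u\<in>I. insert u (\<Union>j\<in>P u. V j))"
    proof (cases "v \<in> I")
      case False
      then have "\<not> ok (insert v I)" using max[of "insert v I"] v I by auto
      then obtain u where "u \<in> I" "P u \<inter> P v \<noteq> {}"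
        using I(2) unfolding ok_def by blast
      then show ?thesis by (auto simp: P_def)
    qed auto
  qed
  then have "card C \<le> card (\<Union>u\<in>I. insert u (\<Union>j\<in>P u. V j))"
    by (rule card_mono[rotated]) (use finI finP V in \<open>auto simp: P_def\<close>)
  also have "\<dots> \<le> (\<Sum>u\<in>I. card (insert u (\<Union>j\<in>P u. V j)))"
    by (rule card_UN_le[OF finI])
  also have "\<dots> \<le> (\<Sum>u\<in>I. 2 * D\<^sup>2 + 1)"
  proof (intro sum_mono)
    fix u assume "u \<in> I"
    then have u: "card (P u) \<le> 2 * D" using I(1) by (auto simp: C_def)
    have "card (\<Union>j\<in>P u. V j) \<le> (\<Sum>j\<in>P u. card (V j))"
      by (rule card_UN_le[OF finP])
    also have "\<dots> \<le> (\<Sum>j\<in>P u. D)"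
      by (intro sum_mono) (use V in \<open>auto simp: P_def\<close>)
    also have "\<dots> \<le> 2 * D * D" using u by simp
    finally have "card (\<Union>j\<in>P u. V j) \<le> 2 * D\<^sup>2" by (simp add: power2_eq_square)
    moreover have "finite (\<Union>j\<in>P u. V j)" using finP V by (auto simp: P_def)
    ultimately show "card (insert u (\<Union>j\<in>P u. V j)) \<le> 2 * D\<^sup>2 + 1"
      by (auto simp: card_insert_if)
  qed
  finally have "card C \<le> card I * (2 * D\<^sup>2 + 1)" by simp
  then have "2 * card L \<le> card J + 2 * (card I * (2 * D\<^sup>2 + 1))"
    using H LHC by linarith
  moreover have "u = v" if "u \<in> I" "v \<in> I" "j \<in> J" "u \<in> V j" "v \<in> V j" for u v j
    using that I(2) by (auto simp: ok_def P_def)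
  moreover have "I \<subseteq> L" and "\<And>u. u \<in> I \<Longrightarrow> card {j\<in>J. u \<in> V j} \<le> 2 * D"
    using I(1) by (auto simp: C_def P_def)
  ultimately show ?thesis by (intro that)
qed

section \<open>Local samplers\<close>

text \<open>A pair \<open>(h, x)\<close> of bit vectors indexed by \<open>J\<close> is encoded as the set of all \<open>(j, False)\<close> with
  \<open>h\<^sub>j = 0\<close> together with all \<open>(j, True)\<close> with \<open>x\<^sub>j = 1\<close>; then \<open>x\<^sub>j (-1)\<^bsup>h\<^sub>j\<^esup> = 1\<close>
  iff both pairs of index \<open>j\<close> are present.\<close>

definition weight :: "('j \<times> bool) set \<Rightarrow> 'j \<Rightarrow> int" where
  "weight Z j = (if (j, True) \<in> Z then if (j, False) \<in> Z then 1 else -1 else 0)"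

definition parity_mm :: "nat \<Rightarrow> 'j set \<Rightarrow> ('j \<times> bool) set \<Rightarrow> bool" where
  "parity_mm p J Z \<longleftrightarrow> MM p (\<Sum>j\<in>J. weight Z j) \<noteq> odd (card {j\<in>J. (j, True) \<in> Z})"

text \<open>The contribution of index j to the Fourier character of frequency \<xi>, with its share
  of the parity sign folded in. The parity is thereby treated as one more multiplicative
  factor.\<close>

definition character :: "nat \<Rightarrow> nat \<Rightarrow> ('j \<times> bool) set \<Rightarrow> 'j \<Rightarrow> complex" where
  "character p \<xi> Z j = cis (2 * pi * real \<xi> * of_int (weight Z j) / real p) * bsign ((j, True) \<in> Z)"

lemma weight_bounds: "weight Z j \<le> 1" "- 1 \<le> weight Z j"
  by (auto simp: weight_def)

lemma weight_eq_1_iff: "weight Z j = 1 \<longleftrightarrow> {j} \<times> UNIV \<subseteq> Z"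
  by (auto simp: weight_def UNIV_bool)

lemma norm_character [simp]: "cmod (character p \<xi> Z j) = 1"
  by (simp add: character_def norm_mult)

lemma prod_bsign: "finite J \<Longrightarrow> (\<Prod>j\<in>J. bsign (Q j)) = bsign (odd (card {j\<in>J. Q j}))"
  by (simp add: bsign_def prod.If_cases Int_def)

lemma prod_character:
  assumes "finite J"
  shows "(\<Prod>j\<in>J. character p \<xi> Z j)
    = cis (2 * pi * real \<xi> * of_int (\<Sum>j\<in>J. weight Z j) / real p)
        * bsign (odd (card {j\<in>J. (j, True) \<in> Z}))"
proof -
  have "2 * pi * real \<xi> * of_int (\<Sum>j\<in>J. weight Z j) / real p
    = (\<Sum>j\<in>J. 2 * pi * real \<xi> * of_int (weight Z j) / real p)"
    by (simp add: sum_distrib_left sum_divide_distrib)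
  then show ?thesis
    using assms by (simp add: character_def prod.distrib prod_bsign cis_sum)
qed

text \<open>A seed is the set A of input positions that carry 1. It splits into Y outside
  \<open>I\<close> and X inside \<open>I\<close>; Y is held fixed while X varies.
  \<open>out_block\<close> says that an index in \<open>P u\<close> sees only u among the inputs in
  \<open>I\<close>, and \<open>out_rest\<close> that an index outside all blocks sees none of them.
  The bound 2E < p prevents two different block weights from agreeing modulo p.\<close>

locale sampler =
  fixes L I :: "'a set" and J :: "'j set" and P :: "'a \<Rightarrow> 'j set"
    and out :: "'a set \<Rightarrow> ('j \<times> bool) set" and E p :: nat
  assumes finite_L: "finite L" and I_subset: "I \<subseteq> L" and finite_J: "finite J"
    and P_subset: "\<And>u. u \<in> I \<Longrightarrow> P u \<subseteq> J"
    and P_disjoint: "\<And>u v. u \<in> I \<Longrightarrow> v \<in> I \<Longrightarrow> u \<noteq> v \<Longrightarrow> P u \<inter> P v = {}"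
    and P_card: "\<And>u. u \<in> I \<Longrightarrow> card (P u) \<le> E"
    and p: "prime p" "2 * E < p" "3 \<le> p"
    and out_subset: "\<And>A. A \<subseteq> L \<Longrightarrow> out A \<subseteq> J \<times> UNIV"
    and out_block: "\<And>u j Y X c. u \<in> I \<Longrightarrow> j \<in> P u \<Longrightarrow> Y \<subseteq> L - I \<Longrightarrow> X \<subseteq> I \<Longrightarrow>
      (j, c) \<in> out (Y \<union> X) \<longleftrightarrow> (j, c) \<in> out (Y \<union> (X \<inter> {u}))"
    and out_rest: "\<And>j Y X c. j \<in> J - (\<Union>u\<in>I. P u) \<Longrightarrow> Y \<subseteq> L - I \<Longrightarrow> X \<subseteq> I \<Longrightarrow>
      (j, c) \<in> out (Y \<union> X) \<longleftrightarrow> (j, c) \<in> out Y"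
begin

lemma finite_I: "finite I"
  using I_subset finite_L finite_subset by blast

lemma finite_P: "u \<in> I \<Longrightarrow> finite (P u)"
  using P_subset finite_J finite_subset by blast

section \<open>Inert and active inputs for a fixed outside assignment\<close>

definition inert :: "'a set \<Rightarrow> 'a set" where
  "inert Y = {u\<in>I. out (insert u Y) = out Y}"

text \<open>Being full in one of the two states is what makes the effect visible in the weight sum:
  a toggle between two non-full states could leave the sum unchanged.\<close>

definition active :: "'a set \<Rightarrow> 'a set" where
  "active Y = {u\<in>I. out (insert u Y) \<noteq> out Y \<and>
     (P u \<times> UNIV \<subseteq> out Y \<or> P u \<times> UNIV \<subseteq> out (insert u Y))}"

lemma active_subset: "active Y \<subseteq> I"
  by (auto simp: active_def)

lemma inert_subset: "inert Y \<subseteq> I"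
  by (auto simp: inert_def)

lemma finite_active: "finite (active Y)"
  using finite_subset[OF active_subset finite_I] .

lemma finite_inert: "finite (inert Y)"
  using finite_subset[OF inert_subset finite_I] .

lemma out_block_in:
  assumes "u \<in> I" "j \<in> P u" "Y \<subseteq> L - I" "X \<subseteq> I"
  shows "(j, c) \<in> out (Y \<union> X) \<longleftrightarrow> (j, c) \<in> out (if u \<in> X then insert u Y else Y)"
  using out_block[OF assms, of c] by auto

lemma out_eqI:
  assumes "Y \<subseteq> L - I" "X \<subseteq> I" "X' \<subseteq> I"
    and "\<And>u j c. u \<in> I \<Longrightarrow> j \<in> P u \<Longrightarrow> (j, c) \<in> out (Y \<union> X) \<longleftrightarrow> (j, c) \<in> out (Y \<union> X')"
  shows "out (Y \<union> X) = out (Y \<union> X')"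
proof -
  have "(j, c) \<in> out (Y \<union> X) \<longleftrightarrow> (j, c) \<in> out (Y \<union> X')" if "j \<in> J" for j c
  proof (cases "j \<in> (\<Union>u\<in>I. P u)")
    case True
    then show ?thesis using assms(4) by blast
  next
    case False
    then have "j \<in> J - (\<Union>u\<in>I. P u)" using that by blast
    then show ?thesis using assms(1-3) by (simp add: out_rest)
  qed
  moreover have "out (Y \<union> X) \<subseteq> J \<times> UNIV" "out (Y \<union> X') \<subseteq> J \<times> UNIV"
    by (intro out_subset; use assms I_subset in blast)+
  ultimately show ?thesis by auto
qed

lemma out_remove_inert:
  assumes "Y \<subseteq> L - I" "X \<subseteq> I"
  shows "out (Y \<union> X) = out (Y \<union> (X - inert Y))"
proof (rule out_eqI)
  fix u j c assume u: "u \<in> I" "j \<in> P u"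
  have X': "X - inert Y \<subseteq> I" using assms(2) by auto
  have "out (if u \<in> X then insert u Y else Y) = out (if u \<in> X - inert Y then insert u Y else Y)"
    by (auto simp: inert_def)
  then show "(j, c) \<in> out (Y \<union> X) \<longleftrightarrow> (j, c) \<in> out (Y \<union> (X - inert Y))"
    by (simp only: out_block_in[OF u assms(1,2)] out_block_in[OF u assms(1) X'])
qed (use assms in auto)

text \<open>For each such Y the inert inputs can be set to 0 without changing the output, which
  leaves at most 2^(card I - R) outputs. Summing over the at most 2^(card L - card I) choices of Y
  gives the bound.\<close>

lemma card_inert_image_le:
  "card (\<Union>Y\<in>{Y\<in>Pow (L - I). R \<le> card (inert Y)}. (\<lambda>X. out (Y \<union> X)) ` Pow I)
     \<le> 2 ^ (card L - R)"
proof -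
  let ?S = "{Y\<in>Pow (L - I). R \<le> card (inert Y)}"
  have fin: "finite ?S" using finite_L by auto
  have IL: "card I \<le> card L" using card_mono[OF finite_L I_subset] .
  have card_Y: "card ((\<lambda>X. out (Y \<union> X)) ` Pow I) \<le> 2 ^ (card I - R)" if "Y \<in> ?S" for Y
  proof -
    have "(\<lambda>X. out (Y \<union> X)) ` Pow I \<subseteq> (\<lambda>X. out (Y \<union> X)) ` Pow (I - inert Y)"
    proof
      fix Z assume "Z \<in> (\<lambda>X. out (Y \<union> X)) ` Pow I"
      then obtain X where X: "X \<subseteq> I" "Z = out (Y \<union> X)" by auto
      then have "Z = out (Y \<union> (X - inert Y))" using out_remove_inert[of Y X] that by auto
      then show "Z \<in> (\<lambda>X. out (Y \<union> X)) ` Pow (I - inert Y)" using X by auto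
    qed
    then have "card ((\<lambda>X. out (Y \<union> X)) ` Pow I)
      \<le> card ((\<lambda>X. out (Y \<union> X)) ` Pow (I - inert Y))"
      using finite_I by (intro card_mono) auto
    also have "\<dots> \<le> card (Pow (I - inert Y))" using finite_I by (intro card_image_le) auto
    also have "\<dots> = 2 ^ (card I - card (inert Y))"
      using finite_I by (simp add: card_Pow card_Diff_subset[OF finite_inert inert_subset])
    also have "\<dots> \<le> 2 ^ (card I - R)"
      using that by (intro power_increasing) auto
    finally show ?thesis .
  qed
  show ?thesis
  proof (cases "?S = {}")
    case True
    show ?thesis unfolding True by simp
  next
    case False
    \<comment> \<open>This makes the truncated subtractions genuine, so that the exponents add up to
      card L - R.\<close>
    then have "R \<le> card I"
      using card_mono[OF finite_I inert_subset] by (auto intro: order_trans)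
    have "card (\<Union>Y\<in>?S. (\<lambda>X. out (Y \<union> X)) ` Pow I)
      \<le> (\<Sum>Y\<in>?S. card ((\<lambda>X. out (Y \<union> X)) ` Pow I))"
      by (rule card_UN_le[OF fin])
    also have "\<dots> \<le> (\<Sum>Y\<in>?S. 2 ^ (card I - R))"
      by (intro sum_mono card_Y)
    also have "\<dots> = card ?S * 2 ^ (card I - R)" by simp
    also have "\<dots> \<le> card (Pow (L - I)) * 2 ^ (card I - R)"
      using finite_L by (intro mult_right_mono card_mono) auto
    also have "\<dots> = 2 ^ (card L - card I + (card I - R))"
      using finite_L finite_I I_subset
      by (simp add: card_Pow card_Diff_subset power_add)
    also have "card L - card I + (card I - R) = card L - R"
      using \<open>R \<le> card I\<close> IL by linarith
    finally show ?thesis .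
  qed
qed

text \<open>The state of block \<open>P u\<close> is one of the two states that u can produce from
  Y. If it is full and u is not inert, then u is active.\<close>

lemma card_full_blocks_le:
  assumes "Y \<subseteq> L - I" "X \<subseteq> I"
  shows "card {u\<in>I. P u \<times> UNIV \<subseteq> out (Y \<union> X)} \<le> card (inert Y) + card (active Y)"
proof -
  have "{u\<in>I. P u \<times> UNIV \<subseteq> out (Y \<union> X)} \<subseteq> inert Y \<union> active Y"
  proof
    fix u assume u: "u \<in> {u\<in>I. P u \<times> UNIV \<subseteq> out (Y \<union> X)}"
    then have "P u \<times> UNIV \<subseteq> out (if u \<in> X then insert u Y else Y)"
      using out_block_in[of u _ Y X] assms by blast
    then show "u \<in> inert Y \<union> active Y"
      using u by (auto simp: inert_def active_def split: if_splits)
  qed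
  then have "card {u\<in>I. P u \<times> UNIV \<subseteq> out (Y \<union> X)} \<le> card (inert Y \<union> active Y)"
    by (intro card_mono) (auto simp: finite_active finite_inert)
  also have "\<dots> \<le> card (inert Y) + card (active Y)" by (rule card_Un_le)
  finally show ?thesis .
qed

text \<open>A full block has the maximal weight, which no other value of the block attains.\<close>

lemma full_block_unique:
  assumes "u \<in> I" "P u \<times> UNIV \<subseteq> Z" "(\<Sum>j\<in>P u. weight Z' j) = (\<Sum>j\<in>P u. weight Z j)"
  shows "P u \<times> UNIV \<subseteq> Z'"
proof -
  have "weight Z j = 1" if "j \<in> P u" for j
    using assms(2) that by (auto simp: weight_eq_1_iff)
  then have "(\<Sum>j\<in>P u. 1 - weight Z' j) = 0"
    using assms(3) by (simp add: sum_subtractf)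
  then have "\<forall>j\<in>P u. 1 - weight Z' j = 0"
    using finite_P[OF assms(1)] by (subst (asm) sum_nonneg_eq_0_iff) (auto simp: weight_bounds)
  then have "\<forall>j\<in>P u. {j} \<times> UNIV \<subseteq> Z'" by (simp add: weight_eq_1_iff[symmetric])
  then show ?thesis by blast
qed

text \<open>Both block weights lie in [-E, E], so a difference divisible by p > 2E would be 0. The
  other state would then have the maximal weight too, hence also be full, and u would be
  inert.\<close>

lemma active_weight_diff:
  assumes u: "u \<in> active Y" and Y: "Y \<subseteq> L - I"
  shows "\<not> int p dvd (\<Sum>j\<in>P u. weight (out (insert u Y)) j) - (\<Sum>j\<in>P u. weight (out Y) j)"
    (is "\<not> _ dvd ?a1 - ?a0")
proof
  have uI: "u \<in> I" using u active_subset by auto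
  assume dvd: "int p dvd ?a1 - ?a0"
  have bound: "\<bar>\<Sum>j\<in>P u. weight Z j\<bar> \<le> int E" for Z
  proof -
    have "\<bar>\<Sum>j\<in>P u. weight Z j\<bar> \<le> (\<Sum>j\<in>P u. \<bar>weight Z j\<bar>)" by (rule sum_abs)
    also have "\<dots> \<le> (\<Sum>j\<in>P u. 1)" by (intro sum_mono) (simp add: weight_def)
    finally show ?thesis using P_card[OF uI] by simp
  qed
  have "\<bar>?a1 - ?a0\<bar> < int p"
    using bound[of "out Y"] bound[of "out (insert u Y)"] p(2) by linarith
  with dvd have eq: "?a1 = ?a0"
    using dvd_imp_le_int[of "?a1 - ?a0" "int p"] by fastforce
  have both: "P u \<times> UNIV \<subseteq> out Y" "P u \<times> UNIV \<subseteq> out (insert u Y)"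
    using u full_block_unique[OF uI _ eq] full_block_unique[OF uI _ eq[symmetric]]
    by (auto simp: active_def)
  have "out (Y \<union> {u}) = out (Y \<union> {})"
  proof (rule out_eqI)
    fix v j c assume v: "v \<in> I" "j \<in> P v"
    show "(j, c) \<in> out (Y \<union> {u}) \<longleftrightarrow> (j, c) \<in> out (Y \<union> {})"
    proof (cases "v = u")
      case True
      then show ?thesis using both v by auto
    next
      case False
      then show ?thesis using out_block_in[OF v Y, of "{u}" c] uI by simp
    qed
  qed (use uI Y in auto)
  then show False using u by (simp add: active_def)
qed

section \<open>Bias of the required bit\<close>

text \<open>For fixed Y the blocks respond to separate inputs, so the product over J splits into a
  constant and one factor per u, and the sum over X becomes a product of two-term sums. Each factor
  is at most 2 by the triangle inequality and is contracted further when u is active.\<close>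

lemma norm_sum_character_le:
  assumes Y: "Y \<subseteq> L - I" and \<xi>: "0 < \<xi>" "\<xi> < p"
  shows "cmod (\<Sum>X\<in>Pow I. \<Prod>j\<in>J. character p \<xi> (out (Y \<union> X)) j)
    \<le> 2 ^ card I * exp (- real (card (active Y)) / (8 * (real p)\<^sup>2))"
proof -
  let ?c = "character p \<xi>"
  let ?U = "\<Union>u\<in>I. P u"
  define B where "B Z u = (\<Prod>j\<in>P u. ?c Z j)" for Z u
  define K where "K = (\<Prod>j\<in>J - ?U. ?c (out Y) j)"
  have [simp]: "cmod (B Z u) = 1" for Z u by (simp add: B_def prod_norm[symmetric])
  have [simp]: "cmod K = 1" by (simp add: K_def prod_norm[symmetric])
  have cong: "?c Z j = ?c Z' j" if "\<And>c. (j, c) \<in> Z \<longleftrightarrow> (j, c) \<in> Z'" for Z Z' j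
    using that by (simp add: character_def weight_def)
  have fac: "(\<Prod>j\<in>J. ?c (out (Y \<union> X)) j)
      = K * (\<Prod>u\<in>I. if u \<in> X then B (out (insert u Y)) u else B (out Y) u)"
    if X: "X \<in> Pow I" for X
  proof -
    have U: "?U \<subseteq> J" using P_subset by auto
    have "(\<Prod>j\<in>J. ?c (out (Y \<union> X)) j)
      = (\<Prod>j\<in>J - ?U. ?c (out (Y \<union> X)) j) * (\<Prod>j\<in>?U. ?c (out (Y \<union> X)) j)"
      by (rule prod.subset_diff[OF U finite_J])
    also have "(\<Prod>j\<in>J - ?U. ?c (out (Y \<union> X)) j) = K"
      unfolding K_def
    proof (rule prod.cong[OF refl])
      fix j assume "j \<in> J - ?U"
      then show "?c (out (Y \<union> X)) j = ?c (out Y) j"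
        using X Y by (intro cong out_rest) auto
    qed
    also have "(\<Prod>j\<in>?U. ?c (out (Y \<union> X)) j) = (\<Prod>u\<in>I. \<Prod>j\<in>P u. ?c (out (Y \<union> X)) j)"
      by (rule prod.UNION_disjoint) (use finite_I finite_P P_disjoint in auto)
    also have "\<dots> = (\<Prod>u\<in>I. if u \<in> X then B (out (insert u Y)) u else B (out Y) u)"
    proof (intro prod.cong refl)
      fix u assume u: "u \<in> I"
      have "(\<Prod>j\<in>P u. ?c (out (Y \<union> X)) j) = B (out (if u \<in> X then insert u Y else Y)) u"
        unfolding B_def
      proof (rule prod.cong[OF refl])
        fix j assume "j \<in> P u"
        then show "?c (out (Y \<union> X)) j = ?c (out (if u \<in> X then insert u Y else Y)) j"
          using u X Y by (intro cong out_block_in) auto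
      qed
      then show "(\<Prod>j\<in>P u. ?c (out (Y \<union> X)) j)
        = (if u \<in> X then B (out (insert u Y)) u else B (out Y) u)" by simp
    qed
    finally show ?thesis .
  qed
  have "(\<Sum>X\<in>Pow I. \<Prod>j\<in>J. ?c (out (Y \<union> X)) j)
    = K * (\<Prod>u\<in>I. B (out (insert u Y)) u + B (out Y) u)"
    unfolding sum_Pow_prod[OF finite_I, symmetric] sum_distrib_left
    by (rule sum.cong[OF refl fac])
  then have "cmod (\<Sum>X\<in>Pow I. \<Prod>j\<in>J. ?c (out (Y \<union> X)) j)
    = (\<Prod>u\<in>I. cmod (B (out (insert u Y)) u + B (out Y) u))"
    by (simp add: norm_mult prod_norm)
  also have "\<dots> \<le> (\<Prod>u\<in>I. 2 * (if u \<in> active Y then exp (- 1 / (8 * (real p)\<^sup>2)) else 1))"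
  proof (intro prod_mono conjI)
    fix u assume u: "u \<in> I"
    let ?B1 = "B (out (insert u Y)) u" and ?B0 = "B (out Y) u"
    show "cmod (?B1 + ?B0) \<le> 2 * (if u \<in> active Y then exp (- 1 / (8 * (real p)\<^sup>2)) else 1)"
    proof (cases "u \<in> active Y")
      case False
      then show ?thesis using norm_triangle_ineq[of ?B1 ?B0] by simp
    next
      case True
      define a where "a Z = (\<Sum>j\<in>P u. weight Z j)" for Z
      define \<tau> where "\<tau> Z = bsign (odd (card {j\<in>P u. (j, True) \<in> Z}))" for Z
      have B: "B Z u = cis (2 * pi * real \<xi> * of_int (a Z) / real p) * \<tau> Z" for Z
        unfolding B_def a_def \<tau>_def by (rule prod_character[OF finite_P[OF u]])
      \<comment> \<open>Pulling out the unit factor \<open>?B0\<close> leaves 1 plus a relative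
        parity sign \<open>\<sigma>\<close> times a p-th root of unity. A sign is its own inverse,
        so the product of the two signs is their quotient.\<close>
      define \<sigma> where "\<sigma> = \<tau> (out (insert u Y)) * \<tau> (out Y)"
      define b where "b = int \<xi> * (a (out (insert u Y)) - a (out Y))"
      have \<tau>2: "\<tau> Z * \<tau> Z = 1" for Z by (simp add: \<tau>_def bsign_def)
      have "?B1 = ?B0 * (\<sigma> * cis (2 * pi * of_int b / real p))"
      proof -
        have "?B0 * (\<sigma> * cis (2 * pi * of_int b / real p))
          = (\<tau> (out Y) * \<tau> (out Y)) * \<tau> (out (insert u Y)) *
            (cis (2 * pi * real \<xi> * of_int (a (out Y)) / real p) * cis (2 * pi * of_int b / real p))"
          by (simp only: B \<sigma>_def mult_ac)
        also have "\<dots> = ?B1"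
          unfolding \<tau>2 cis_mult B
          by (simp add: b_def algebra_simps diff_divide_distrib)
        finally show ?thesis ..
      qed
      then have "?B1 + ?B0 = ?B0 * (1 + \<sigma> * cis (2 * pi * of_int b / real p))"
        by (simp add: algebra_simps)
      then have "cmod (?B1 + ?B0) = cmod (1 + \<sigma> * cis (2 * pi * of_int b / real p))"
        by (simp add: norm_mult)
      also have "\<dots> \<le> 2 * exp (- 1 / (8 * (real p)\<^sup>2))"
      proof (rule norm_one_plus_cis_le)
        have "\<not> int p dvd int \<xi>" using \<xi> by (auto dest: dvd_imp_le)
        then show "\<not> int p dvd b"
          using active_weight_diff[OF True Y] p(1)
          by (simp add: b_def a_def prime_dvd_mult_iff)
        show "\<sigma> = 1 \<or> \<sigma> = -1" by (simp add: \<sigma>_def \<tau>_def bsign_def)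
      qed (use p in auto)
      finally show ?thesis using True by simp
    qed
  qed simp
  also have "\<dots> = 2 ^ card I * exp (- 1 / (8 * (real p)\<^sup>2)) ^ card (active Y)"
  proof -
    have "I \<inter> active Y = active Y" using active_subset by auto
    then show ?thesis
      using finite_I by (simp add: prod.distrib prod.If_cases)
  qed
  also have "exp (- 1 / (8 * (real p)\<^sup>2)) ^ card (active Y)
    = exp (- real (card (active Y)) / (8 * (real p)\<^sup>2))"
    by (simp flip: exp_of_nat_mult)
  finally show ?thesis .
qed

text \<open>Expanding MM in characters bounds frequency 0 by its coefficient 1/p, with no
  cancellation claimed for the remaining parity sign. The other p - 1 frequencies each have the
  exponential decay supplied by the active inputs.\<close>

lemma bias_parity_mm_le:
  assumes Y: "Y \<subseteq> L - I" and t: "t \<le> card (active Y)"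
  shows "cmod (\<Sum>X\<in>Pow I. bsign (parity_mm p J (out (Y \<union> X))))
    \<le> 2 ^ card I * (1 / real p + real p * exp (- real t / (8 * (real p)\<^sup>2)))"
proof -
  have "odd p" using p(1,3) by (intro prime_odd_nat) auto
  then obtain c where c: "\<And>s. bsign (MM p s) = (\<Sum>\<xi><p. c \<xi> * cis (2 * pi * real \<xi> * of_int s / real p))"
    and c0: "cmod (c 0) = 1 / real p" and c1: "\<And>\<xi>. cmod (c \<xi>) \<le> 1"
    using bsign_MM_fourier by blast
  let ?S = "\<lambda>\<xi>. \<Sum>X\<in>Pow I. \<Prod>j\<in>J. character p \<xi> (out (Y \<union> X)) j"
  let ?e = "exp (- real t / (8 * (real p)\<^sup>2))"
  have "bsign (parity_mm p J Z) = (\<Sum>\<xi><p. c \<xi> * (\<Prod>j\<in>J. character p \<xi> Z j))" for Z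
  proof -
    have "bsign (parity_mm p J Z)
      = bsign (MM p (\<Sum>j\<in>J. weight Z j)) * bsign (odd (card {j\<in>J. (j, True) \<in> Z}))"
      by (simp add: parity_mm_def bsign_def)
    then show ?thesis
      by (simp only: c prod_character[OF finite_J] sum_distrib_right mult.assoc)
  qed
  then have "(\<Sum>X\<in>Pow I. bsign (parity_mm p J (out (Y \<union> X)))) = (\<Sum>\<xi><p. c \<xi> * ?S \<xi>)"
    by (simp only: sum_distrib_left) (rule sum.swap)
  also have "\<dots> = c 0 * ?S 0 + (\<Sum>\<xi>\<in>{..<p} - {0}. c \<xi> * ?S \<xi>)"
    using p(3) by (intro sum.remove) auto
  also have "cmod \<dots> \<le> 1 / real p * 2 ^ card I + (\<Sum>\<xi>\<in>{..<p} - {0}. 2 ^ card I * ?e)"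
  proof (intro norm_triangle_mono sum_norm_le)
    have "cmod (?S 0) \<le> (\<Sum>X\<in>Pow I. 1)"
      by (intro sum_norm_le) (simp add: prod_norm[symmetric])
    then have "cmod (?S 0) \<le> 2 ^ card I" by (simp add: card_Pow finite_I)
    then show "cmod (c 0 * ?S 0) \<le> 1 / real p * 2 ^ card I"
      unfolding norm_mult c0 by (intro mult_left_mono) auto
  next
    fix \<xi> assume "\<xi> \<in> {..<p} - {0}"
    then have "cmod (?S \<xi>) \<le> 2 ^ card I * exp (- real (card (active Y)) / (8 * (real p)\<^sup>2))"
      by (intro norm_sum_character_le Y) auto
    also have "\<dots> \<le> 2 ^ card I * ?e"
      using t by (intro mult_left_mono) (auto intro!: divide_right_mono)
    finally have "cmod (c \<xi>) * cmod (?S \<xi>) \<le> 1 * (2 ^ card I * ?e)"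
      using c1 by (intro mult_mono) auto
    then show "cmod (c \<xi> * ?S \<xi>) \<le> 2 ^ card I * ?e" by (simp add: norm_mult)
  qed
  also have "\<dots> = 2 ^ card I * (1 / real p + real (p - 1) * ?e)"
    using p(3) by (simp add: algebra_simps)
  also have "\<dots> \<le> 2 ^ card I * (1 / real p + real p * ?e)"
    by (intro mult_left_mono add_left_mono mult_right_mono) auto
  finally show ?thesis .
qed

end

section \<open>A test that separates the sampler from the target\<close>

context sampler
begin

text \<open>The outputs reachable from assignments Y with at least R inert inputs. Together with
  \<open>sparse\<close> it forms a small collection, which a uniform encoding rarely hits.\<close>

definition inert_image :: "nat \<Rightarrow> ('j \<times> bool) set set" where
  "inert_image R =
     (\<Union>Y\<in>{Y\<in>Pow (L - I). R \<le> card (inert Y)}. (\<lambda>X. out (Y \<union> X)) ` Pow I)"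

definition sparse :: "nat \<Rightarrow> ('j \<times> bool) set set" where
  "sparse r = {Z\<in>Pow (J \<times> UNIV). card {u\<in>I. P u \<times> UNIV \<subseteq> Z} < r}"

lemma finite_inert_image: "finite (inert_image R)"
  using finite_L finite_I by (auto simp: inert_image_def)

lemma finite_sparse: "finite (sparse r)"
  using finite_J by (auto simp: sparse_def)

lemma card_sparse_le:
  "real (card (sparse r)) \<le> 2 ^ (2 * card J) * 2 ^ r * exp (- real (card I) / (2 * 2 ^ (2 * E)))"
proof -
  have "card (J \<times> (UNIV :: bool set)) = 2 * card J"
    by (simp add: card_cartesian_product)
  moreover have "real (card (sparse r))
    \<le> 2 ^ card (J \<times> (UNIV :: bool set)) * 2 ^ r * exp (- real (card I) / (2 * 2 ^ (2 * E)))"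
    unfolding sparse_def
  proof (rule card_few_blocks_le)
    show "P u \<times> UNIV \<inter> P v \<times> UNIV = {}" if "u \<in> I" "v \<in> I" "u \<noteq> v" for u v
      using P_disjoint[OF that] by blast
    show "card (P u \<times> (UNIV :: bool set)) \<le> 2 * E" if "u \<in> I" for u
      using P_card[OF that] by (simp add: card_cartesian_product)
    show "P u \<times> UNIV \<subseteq> J \<times> UNIV" if "u \<in> I" for u
      using P_subset[OF that] by blast
  qed (use finite_I finite_J in auto)
  ultimately show ?thesis by simp
qed

text \<open>The sum of signs, multiplied by the sign of the constant guess \<beta>, counts correct
  minus wrong guesses. A small bias therefore leaves nearly half of the guesses wrong.\<close>

lemma card_wrong_ge:
  assumes Y: "Y \<subseteq> L - I" and t: "t \<le> card (active Y)"
  shows "2 ^ card I * (1 / 2 - (1 / real p + real p * exp (- real t / (8 * (real p)\<^sup>2))) / 2)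
    \<le> real (card {X\<in>Pow I. \<beta> \<noteq> parity_mm p J (out (Y \<union> X))})"
proof -
  let ?q = "\<lambda>X. parity_mm p J (out (Y \<union> X))"
  have fin: "finite (Pow I)" using finite_I by simp
  have "(\<Sum>X\<in>Pow I. bsign (?q X) * bsign \<beta>)
    = (\<Sum>X\<in>Pow I. 1 - 2 * (if \<beta> \<noteq> ?q X then 1 else 0))"
    by (intro sum.cong refl) (simp add: bsign_def)
  also have "\<dots> = complex_of_real (2 ^ card I - 2 * real (card {X\<in>Pow I. \<beta> \<noteq> ?q X}))"
    using fin finite_I by (simp add: sum_subtractf sum.If_cases Int_def card_Pow
        flip: sum_distrib_left)
  finally have "cmod (\<Sum>X\<in>Pow I. bsign (?q X) * bsign \<beta>)
    = \<bar>2 ^ card I - 2 * real (card {X\<in>Pow I. \<beta> \<noteq> ?q X})\<bar>"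
    by (simp only: norm_of_real)
  moreover have "cmod (\<Sum>X\<in>Pow I. bsign (?q X) * bsign \<beta>) = cmod (\<Sum>X\<in>Pow I. bsign (?q X))"
    by (simp add: norm_mult flip: sum_distrib_right)
  moreover define \<eta> where "\<eta> = 1 / real p + real p * exp (- real t / (8 * (real p)\<^sup>2))"
  ultimately have "2 ^ card I - 2 * real (card {X\<in>Pow I. \<beta> \<noteq> ?q X}) \<le> 2 ^ card I * \<eta>"
    using bias_parity_mm_le[OF Y t] unfolding \<eta>_def by linarith
  then show ?thesis unfolding \<eta>_def[symmetric] by (simp add: algebra_simps)
qed

text \<open>The assignments Y are treated one at a time. With at least R inert inputs all outputs
  lie in \<open>inert_image R\<close>. With fewer than R inert and fewer than t active inputs all
  outputs have fewer than R + t full blocks. Otherwise at least t inputs are active, and \<beta>,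
  constant once Y is fixed, is wrong about half of the time.\<close>

lemma card_caught_ge:
  assumes \<beta>: "\<And>Y X. Y \<subseteq> L - I \<Longrightarrow> X \<subseteq> I \<Longrightarrow> \<beta> (Y \<union> X) = \<beta> Y"
  shows "2 ^ card L * (1 / 2 - (1 / real p + real p * exp (- real t / (8 * (real p)\<^sup>2))) / 2)
    \<le> real (card {A\<in>Pow L. out A \<in> inert_image R \<union> sparse (R + t)
         \<or> \<beta> A \<noteq> parity_mm p J (out A)})"
proof -
  define \<eta> where "\<eta> = (1 / real p + real p * exp (- real t / (8 * (real p)\<^sup>2))) / 2"
  have \<eta>: "\<eta> \<ge> 0" by (simp add: \<eta>_def)
  let ?C = "\<lambda>A. out A \<in> inert_image R \<union> sparse (R + t) \<or> \<beta> A \<noteq> parity_mm p J (out A)"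
  have fin: "finite (Pow I)" using finite_I by simp
  have per_Y: "2 ^ card I * (1 / 2 - \<eta>) \<le> real (card {X\<in>Pow I. ?C (Y \<union> X)})"
    if "Y \<in> Pow (L - I)" for Y
  proof -
    have Y: "Y \<subseteq> L - I" using that by auto
    have all: ?thesis if "\<And>X. X \<subseteq> I \<Longrightarrow> ?C (Y \<union> X)"
    proof -
      have "{X\<in>Pow I. ?C (Y \<union> X)} = Pow I" using that by auto
      then have "real (card {X\<in>Pow I. ?C (Y \<union> X)}) = 2 ^ card I"
        by (simp add: card_Pow finite_I)
      moreover have "2 ^ card I * (1 / 2 - \<eta>) \<le> 2 ^ card I * 1"
        using \<eta> by (intro mult_left_mono) auto
      ultimately show ?thesis by simp
    qed
    consider "R \<le> card (inert Y)" | "card (inert Y) < R" "card (active Y) < t"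
      | "t \<le> card (active Y)" by linarith
    then show ?thesis
    proof cases
      case 1
      then have "out (Y \<union> X) \<in> inert_image R" if "X \<subseteq> I" for X
        using Y that by (auto simp: inert_image_def)
      then show ?thesis by (intro all) auto
    next
      case 2
      have "out (Y \<union> X) \<in> sparse (R + t)" if X: "X \<subseteq> I" for X
      proof -
        have "out (Y \<union> X) \<subseteq> J \<times> UNIV" by (rule out_subset) (use X Y I_subset in blast)
        then show ?thesis
          using card_full_blocks_le[OF Y X] 2 by (simp add: sparse_def)
      qed
      then show ?thesis by (intro all) auto
    next
      case 3
      have "2 ^ card I * (1 / 2 - \<eta>) \<le> real (card {X\<in>Pow I. \<beta> Y \<noteq> parity_mm p J (out (Y \<union> X))})"
        unfolding \<eta>_def by (rule card_wrong_ge[OF Y 3])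
      also have "\<dots> \<le> real (card {X\<in>Pow I. ?C (Y \<union> X)})"
        using fin \<beta>[OF Y] by (intro of_nat_mono card_mono) auto
      finally show ?thesis .
    qed
  qed
  have "2 ^ card L * (1 / 2 - \<eta>) = (\<Sum>Y\<in>Pow (L - I). 2 ^ card I * (1 / 2 - \<eta>))"
  proof -
    have "card L = card (L - I) + card I"
      using I_subset finite_L finite_I
      by (simp add: card_Diff_subset card_mono)
    then show ?thesis using finite_L by (simp add: card_Pow power_add)
  qed
  also have "\<dots> \<le> (\<Sum>Y\<in>Pow (L - I). real (card {X\<in>Pow I. ?C (Y \<union> X)}))"
    by (intro sum_mono per_Y)
  also have "\<dots> = real (card {A\<in>Pow L. ?C A})"
    by (simp only: card_Pow_split[OF finite_L I_subset] of_nat_sum)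
  finally show ?thesis unfolding \<eta>_def .
qed

end

section \<open>Root paths in the tree and the encoding of strings as sets\<close>

lemma finite_path_edges: "finite (path_edges i)"
  by (induction i rule: path_edges.induct) auto

lemma path_edges_bounds: "e \<in> path_edges i \<Longrightarrow> 1 \<le> e \<and> e \<le> i"
  by (induction i rule: path_edges.induct) auto

lemma hbit_0 [simp]: "\<not> hbit d 0"
  by (simp add: hbit_def)

lemma hbit_Suc: "hbit d (Suc i) \<longleftrightarrow> d (Suc i) \<noteq> hbit d (i div 2)"
proof -
  have notin: "Suc i \<notin> path_edges (i div 2)"
    using path_edges_bounds[of "Suc i" "i div 2"] by auto
  have "{j\<in>path_edges (Suc i). d j} = (if d (Suc i) then {Suc i} else {}) \<union> {j\<in>path_edges (i div 2). d j}"
    by auto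
  then show ?thesis
    using notin by (simp add: hbit_def finite_path_edges card_insert_if)
qed

text \<open>Passing to the parent at least halves i + 1, so after q steps the index is at most M and
  no later edge counts.\<close>

lemma card_low_path_edges_le:
  "i + 1 \<le> 2 ^ q * (M + 1) \<Longrightarrow> card {e\<in>path_edges i. M < e} \<le> q"
proof (induction q arbitrary: i)
  case 0
  then have empty: "{e\<in>path_edges i. M < e} = {}" using path_edges_bounds by fastforce
  show ?case unfolding empty by simp
next
  case (Suc q)
  show ?case
  proof (cases i)
    case (Suc k)
    have "k div 2 + 1 \<le> 2 ^ q * (M + 1)"
      using Suc.prems \<open>i = Suc k\<close> by simp
    then have "card {e\<in>path_edges (k div 2). M < e} \<le> q" by (rule Suc.IH)
    moreover have "{e\<in>path_edges i. M < e} \<subseteq> insert i {e\<in>path_edges (k div 2). M < e}"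
      using \<open>i = Suc k\<close> by auto
    then have "card {e\<in>path_edges i. M < e} \<le> card (insert i {e\<in>path_edges (k div 2). M < e})"
      by (intro card_mono) (auto simp: finite_path_edges)
    ultimately show ?thesis
      by (simp add: card_insert_if finite_path_edges split: if_splits)
  qed simp
qed

definition encode :: "nat \<Rightarrow> bool list \<Rightarrow> (nat \<times> bool) set" where
  "encode m z = {(j, c). j \<in> {1..m} \<and>
     (if c then z ! (m + j - 1) else \<not> hbit (\<lambda>i. z ! (i - 1)) j)}"

lemma encode_subset: "encode m z \<subseteq> {1..m} \<times> UNIV"
  by (auto simp: encode_def)

text \<open>The edge bits are recovered from h, since each is the exclusive or of h at the vertex
  and at its parent. Hence a uniform string has a uniform encoding.\<close>

lemma inj_on_encode: "inj_on (encode m) (bitstrings (2 * m))"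
proof (rule inj_onI)
  fix z z' assume len: "z \<in> bitstrings (2 * m)" "z' \<in> bitstrings (2 * m)"
    and eq: "encode m z = encode m z'"
  let ?d = "\<lambda>z i. z ! (i - 1) :: bool"
  have mem: "(j, c) \<in> encode m z \<longleftrightarrow> (j, c) \<in> encode m z'" for j c using eq by simp
  have h: "hbit (?d z) j = hbit (?d z') j" if "j \<le> m" for j
    using mem[of j False] that by (cases "j = 0") (auto simp: encode_def)
  have d: "z ! i = z' ! i" if "i < m" for i
    using h[of "Suc i"] h[of "i div 2"] that by (auto simp: hbit_Suc)
  have x: "z ! (m + i) = z' ! (m + i)" if "i < m" for i
    using mem[of "Suc i" True] that by (simp add: encode_def)
  show "z = z'"
  proof (rule nth_equalityI)
    show "length z = length z'" using len by (simp add: bitstrings_def)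
    fix i assume "i < length z"
    then have i: "i < 2 * m" using len by (simp add: bitstrings_def)
    show "z ! i = z' ! i"
    proof (cases "i < m")
      case False
      then show ?thesis using x[of "i - m"] i by simp
    qed (rule d)
  qed
qed

text \<open>Allows the encoding to be read off a full output whose last bit is the appended
  answer.\<close>

lemma encode_append:
  assumes "length z = 2 * m"
  shows "encode m (z @ ys) = encode m z"
proof -
  have nth: "(z @ ys) ! i = z ! i" if "i < 2 * m" for i
    using that assms by (simp add: nth_append)
  have "hbit (\<lambda>i. (z @ ys) ! (i - 1)) j = hbit (\<lambda>i. z ! (i - 1)) j" if "j \<in> {1..m}" for j
  proof -
    have "{e\<in>path_edges j. (z @ ys) ! (e - 1)} = {e\<in>path_edges j. z ! (e - 1)}"
      using path_edges_bounds[of _ j] that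
      by (intro Collect_cong conj_cong refl nth) fastforce
    then show ?thesis by (simp add: hbit_def)
  qed
  moreover have "(z @ ys) ! (m + j - 1) = z ! (m + j - 1)" if "j \<in> {1..m}" for j
    using that by (intro nth) auto
  ultimately show ?thesis by (auto simp: encode_def)
qed

lemma pmmajmod_eq_parity_mm: "pmmajmod p (m + 1) z = parity_mm p {1..m} (encode m z)"
proof -
  have "(\<Sum>i\<in>{1..m}. if z ! (m + i - 1) then if hbit (\<lambda>j. z ! (j - 1)) i then - 1 else 1 else 0)
    = (\<Sum>j\<in>{1..m}. weight (encode m z) j)"
    by (intro sum.cong refl) (simp add: weight_def encode_def)
  moreover have "{i\<in>{1..m}. z ! (m + i - 1)} = {j\<in>{1..m}. (j, True) \<in> encode m z}"
    by (auto simp: encode_def)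
  ultimately show ?thesis
    unfolding pmmajmod_def parity_mm_def Let_def add_diff_cancel_right' by (simp only:)
qed

section \<open>Total variation distance and counting of bit strings\<close>

lemma tvd_ge: "measure_pmf.prob D1 T - measure_pmf.prob D2 T \<le> tvd D1 D2"
proof -
  have "bdd_above (range (\<lambda>T. \<bar>measure_pmf.prob D1 T - measure_pmf.prob D2 T\<bar>))"
  proof (rule bdd_aboveI2)
    fix T
    show "\<bar>measure_pmf.prob D1 T - measure_pmf.prob D2 T\<bar> \<le> 1"
      using measure_pmf.prob_le_1[of D1 T] measure_pmf.prob_le_1[of D2 T]
        measure_nonneg[of D1 T] measure_nonneg[of D2 T] by linarith
  qed
  then have "\<bar>measure_pmf.prob D1 T - measure_pmf.prob D2 T\<bar> \<le> tvd D1 D2"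
    unfolding tvd_def by (rule cSUP_upper[rotated]) simp
  then show ?thesis by linarith
qed

lemma finite_bitstrings: "finite (bitstrings l)"
  using finite_lists_length_eq[of "UNIV :: bool set" l] by (simp add: bitstrings_def)

lemma card_bitstrings: "card (bitstrings l) = 2 ^ l"
  using card_lists_length_eq[of "UNIV :: bool set" l] by (simp add: bitstrings_def)

lemma prob_map_bitstrings:
  "measure_pmf.prob (map_pmf f (pmf_of_set (bitstrings l))) T
    = real (card {z\<in>bitstrings l. f z \<in> T}) / 2 ^ l"
proof -
  have ne: "bitstrings l \<noteq> {}"
    using card_bitstrings[of l] by auto
  have "bitstrings l \<inter> f -` T = {z\<in>bitstrings l. f z \<in> T}" by auto
  then show ?thesis
    by (simp add: measure_map_pmf measure_pmf_of_set[OF ne finite_bitstrings] card_bitstrings)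
qed

definition bits_of_set :: "nat \<Rightarrow> nat set \<Rightarrow> bool list" where
  "bits_of_set l A = map (\<lambda>i. i \<in> A) [0..<l]"

lemma length_bits_of_set [simp]: "length (bits_of_set l A) = l"
  by (simp add: bits_of_set_def)

lemma nth_bits_of_set [simp]: "i < l \<Longrightarrow> bits_of_set l A ! i \<longleftrightarrow> i \<in> A"
  by (simp add: bits_of_set_def)

lemma bij_betw_bits_of_set: "bij_betw (bits_of_set l) (Pow {..<l}) (bitstrings l)"
proof (rule bij_betw_byWitness[where f' = "\<lambda>z. {i. i < l \<and> z ! i}"])
  show "\<forall>z\<in>bitstrings l. bits_of_set l {i. i < l \<and> z ! i} = z"
    by (auto simp: bitstrings_def intro: nth_equalityI)
qed (auto simp: bitstrings_def)

lemma card_bitstrings_Collect: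
  "card {z\<in>bitstrings l. Q z} = card {A\<in>Pow {..<l}. Q (bits_of_set l A)}"
proof -
  have "bits_of_set l ` {A\<in>Pow {..<l}. Q (bits_of_set l A)} = {z\<in>bitstrings l. Q z}"
    by (simp only: bij_betw_imp_surj_on[OF bij_betw_bits_of_set[of l], symmetric] Compr_image_eq)
  moreover have "inj_on (bits_of_set l) {A\<in>Pow {..<l}. Q (bits_of_set l A)}"
    using bij_betw_imp_inj_on[OF bij_betw_bits_of_set] by (rule inj_on_subset) blast
  then have "card (bits_of_set l ` {A\<in>Pow {..<l}. Q (bits_of_set l A)})
    = card {A\<in>Pow {..<l}. Q (bits_of_set l A)}" by (rule card_image)
  ultimately show ?thesis by (simp only:)
qed

section \<open>Distance bounds for short seeds and for local functions\<close>

text \<open>The test is the image of f. It has at most 2^l elements, and appending a bit is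
  injective, so the target meets it for at most 2^l of its 2^N strings.\<close>

lemma tvd_short_seed_ge:
  assumes "\<forall>x\<in>bitstrings l. length (f x) = N + 1"
  shows "1 - 2 ^ l / 2 ^ N \<le> tvd (map_pmf f (pmf_of_set (bitstrings l)))
    (map_pmf (\<lambda>z. z @ [b z]) (pmf_of_set (bitstrings N)))"
proof -
  let ?T = "f ` bitstrings l"
  let ?g = "\<lambda>z. z @ [b z]"
  have "{z\<in>bitstrings l. f z \<in> ?T} = bitstrings l" by auto
  then have 1: "measure_pmf.prob (map_pmf f (pmf_of_set (bitstrings l))) ?T = 1"
    unfolding prob_map_bitstrings by (simp add: card_bitstrings)
  have "card {z\<in>bitstrings N. ?g z \<in> ?T} \<le> card ?T"
    by (rule card_inj_on_le[of ?g]) (auto simp: finite_bitstrings intro: inj_onI)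
  also have "\<dots> \<le> 2 ^ l"
    using card_image_le[OF finite_bitstrings[of l], of f] by (simp add: card_bitstrings)
  finally have "real (card {z\<in>bitstrings N. ?g z \<in> ?T}) \<le> real (2 ^ l)"
    by (rule of_nat_mono)
  then have "measure_pmf.prob (map_pmf ?g (pmf_of_set (bitstrings N))) ?T \<le> 2 ^ l / 2 ^ N"
    unfolding prob_map_bitstrings by (intro divide_right_mono) auto
  then show ?thesis using 1 tvd_ge[of _ ?T] by (smt (verit))
qed

text \<open>M is the index up to which edge bits are frozen, and q bounds the number of path edges
  beyond it. The three losses are the bias of the required bit and the shares of
  \<open>inert_image R\<close> and \<open>sparse (R + t)\<close> among all encodings.\<close>

lemma tvd_local_ge:
  fixes m k q M l p R t D :: nat
  assumes local: "is_local dd l (2 * m + 1) f" "dd \<le> real k"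
    and q: "m + 1 \<le> 2 ^ q * (M + 1)" and M: "4 * (k * (M + 1)) \<le> m" and l: "m \<le> l"
    and D: "k * (q + 1) \<le> D" "0 < D" and p: "prime p" "4 * D < p" "3 \<le> p"
  shows "1 / 2 - (1 / real p + real p * exp (- real t / (8 * (real p)\<^sup>2))) / 2
      - 2 ^ (l - R) / 2 ^ (2 * m)
      - 2 ^ (R + t) * exp (- real m / (8 * (2 * (real D)\<^sup>2 + 1) * 2 ^ (4 * D)))
    \<le> tvd (map_pmf f (pmf_of_set (bitstrings l)))
        (map_pmf (\<lambda>z. z @ [pmmajmod p (m + 1) z]) (pmf_of_set (bitstrings (2 * m))))"
proof -
  define g where "g A = f (bits_of_set l A)" for A
  have "\<forall>i<2 * m + 1. \<exists>S. S \<subseteq> {..<l} \<and> card S \<le> k \<and>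
      (\<forall>A A'. A \<inter> S = A' \<inter> S \<longrightarrow> g A ! i = g A' ! i)"
  proof (intro allI impI)
    fix i assume "i < 2 * m + 1"
    then obtain S where S: "S \<subseteq> {..<l}" "real (card S) \<le> dd"
      and dep: "\<And>x y. length x = l \<Longrightarrow> length y = l \<Longrightarrow> \<forall>j\<in>S. x ! j = y ! j \<Longrightarrow> f x ! i = f y ! i"
      using local(1) unfolding is_local_def by blast
    have "g A ! i = g A' ! i" if AA': "A \<inter> S = A' \<inter> S" for A A'
      unfolding g_def
    proof (rule dep)
      show "\<forall>j\<in>S. bits_of_set l A ! j = bits_of_set l A' ! j"
      proof
        fix j assume "j \<in> S"
        then have "j < l" "j \<in> A \<longleftrightarrow> j \<in> A'" using S(1) AA' by blast+
        then show "bits_of_set l A ! j = bits_of_set l A' ! j" by simp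
      qed
    qed auto
    moreover have "card S \<le> k" using S(2) local(2) by linarith
    ultimately show "\<exists>S. S \<subseteq> {..<l} \<and> card S \<le> k \<and>
        (\<forall>A A'. A \<inter> S = A' \<inter> S \<longrightarrow> g A ! i = g A' ! i)"
      using S(1) by blast
  qed
  then obtain S where S: "\<And>i. i < 2 * m + 1 \<Longrightarrow> S i \<subseteq> {..<l} \<and> card (S i) \<le> k"
    and dep: "\<And>i A A'. i < 2 * m + 1 \<Longrightarrow> A \<inter> S i = A' \<inter> S i \<Longrightarrow> g A ! i = g A' ! i"
    by metis
  have finS: "finite (S i)" if "i < 2 * m + 1" for i
    using S[OF that] finite_subset by blast
  define W where "W = (\<Union>j\<in>{1..min M m}. S (j - 1)) \<union> S (2 * m)"
  \<comment> \<open>Outside W, the pair (h_j, x_j) depends only on the inputs of x_j and of the at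
    most q path edges beyond M, that is, of at most q + 1 output bits.\<close>
  define V where "V j = (S (m + j - 1) \<union> (\<Union>e\<in>{e\<in>path_edges j. M < e}. S (e - 1))) - W" for j
  have finW: "finite W"
    unfolding W_def by (intro finite_UnI finite_UN_I finS) auto
  have cardW: "card W \<le> k * (M + 1)"
  proof -
    have "card (\<Union>j\<in>{1..min M m}. S (j - 1)) \<le> (\<Sum>j\<in>{1..min M m}. card (S (j - 1)))"
      by (rule card_UN_le) simp
    also have "\<dots> \<le> (\<Sum>j\<in>{1..min M m}. k)" using S by (intro sum_mono) auto
    also have "\<dots> \<le> M * k" by simp
    finally have "card W \<le> M * k + k"
      using card_Un_le[of "\<Union>j\<in>{1..min M m}. S (j - 1)" "S (2 * m)"] S[of "2 * m"]
      unfolding W_def by simp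
    then show ?thesis by (simp add: algebra_simps)
  qed
  have V: "finite (V j) \<and> card (V j) \<le> D" if j: "j \<in> {1..m}" for j
  proof -
    let ?E = "{e\<in>path_edges j. M < e}"
    have finE: "finite ?E" by (simp add: finite_path_edges)
    have E: "e - 1 < 2 * m + 1" if "e \<in> ?E" for e
      using path_edges_bounds[of e j] that j by auto
    have "card (\<Union>e\<in>?E. S (e - 1)) \<le> (\<Sum>e\<in>?E. card (S (e - 1)))"
      by (rule card_UN_le[OF finE])
    also have "\<dots> \<le> (\<Sum>e\<in>?E. k)" using S E by (intro sum_mono) blast
    also have "\<dots> \<le> q * k"
      using card_low_path_edges_le[of j q M] q j by simp
    finally have "card (\<Union>e\<in>?E. S (e - 1)) \<le> q * k" .
    moreover have "card (S (m + j - 1)) \<le> k" using S[of "m + j - 1"] j by auto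
    ultimately have "card (S (m + j - 1) \<union> (\<Union>e\<in>?E. S (e - 1))) \<le> k + q * k"
      using card_Un_le[of "S (m + j - 1)" "\<Union>e\<in>?E. S (e - 1)"] by linarith
    moreover have fin: "finite (S (m + j - 1) \<union> (\<Union>e\<in>?E. S (e - 1)))"
      using finE E finS j by auto
    ultimately have "card (V j) \<le> k + q * k"
      unfolding V_def using card_mono[OF fin Diff_subset[of _ W]] by linarith
    then show ?thesis using D fin by (simp add: V_def algebra_simps)
  qed
  obtain I where I: "I \<subseteq> {..<l} - W" "\<And>u. u \<in> I \<Longrightarrow> card {j\<in>{1..m}. u \<in> V j} \<le> 2 * D"
    and I_inj: "\<And>u v j. u \<in> I \<Longrightarrow> v \<in> I \<Longrightarrow> j \<in> {1..m} \<Longrightarrow> u \<in> V j \<Longrightarrow> v \<in> V j \<Longrightarrow> u = v"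
    and I_card: "2 * card ({..<l} - W) \<le> card {1..m} + 2 * (card I * (2 * D\<^sup>2 + 1))"
    using independent_vertices_exist[of "{1..m}" "{..<l} - W" D V] V D(2) by auto
  define P where "P u = {j\<in>{1..m}. u \<in> V j}" for u
  define out where "out A = encode m (g A)" for A
  have out_dep: "(j, c) \<in> out A \<longleftrightarrow> (j, c) \<in> out A'"
    if j: "j \<in> {1..m}" and AA': "A \<inter> (V j \<union> W) = A' \<inter> (V j \<union> W)" for j c A A'
  proof -
    have sub: "g A ! i = g A' ! i" if "i < 2 * m + 1" "S i \<subseteq> V j \<union> W" for i
      using dep[OF that(1), of A A'] AA' that(2) by blast
    have "g A ! (m + j - 1) = g A' ! (m + j - 1)"
      using j by (intro sub) (auto simp: V_def)
    moreover have "g A ! (e - 1) = g A' ! (e - 1)" if e: "e \<in> path_edges j" for e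
    proof (rule sub)
      have e': "1 \<le> e" "e \<le> m" using path_edges_bounds[OF e] j by auto
      then show "e - 1 < 2 * m + 1" by simp
      show "S (e - 1) \<subseteq> V j \<union> W"
      proof (cases "e \<le> M")
        case True
        then have "S (e - 1) \<subseteq> W" using e' by (auto simp: W_def)
        then show ?thesis by blast
      next
        case False
        then show ?thesis using e by (auto simp: V_def)
      qed
    qed
    then have "{e\<in>path_edges j. g A ! (e - 1)} = {e\<in>path_edges j. g A' ! (e - 1)}" by auto
    ultimately show ?thesis by (simp add: out_def encode_def hbit_def)
  qed
  interpret sampler "{..<l}" I "{1..m}" P out "2 * D" p
  proof
    show "P u \<inter> P v = {}" if "u \<in> I" "v \<in> I" "u \<noteq> v" for u v
      using I_inj[OF that(1,2)] that(3) by (auto simp: P_def)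
    show "out A \<subseteq> {1..m} \<times> UNIV" for A
      unfolding out_def by (rule encode_subset)
    show "(j, c) \<in> out (Y \<union> X) \<longleftrightarrow> (j, c) \<in> out (Y \<union> (X \<inter> {u}))"
      if "u \<in> I" "j \<in> P u" "X \<subseteq> I" for u j Y X c
    proof (rule out_dep)
      have "v = u" if "v \<in> X" "v \<in> V j" for v
        using I_inj[of v u j] that \<open>u \<in> I\<close> \<open>j \<in> P u\<close> \<open>X \<subseteq> I\<close> by (auto simp: P_def)
      moreover have "X \<inter> W = {}" using \<open>X \<subseteq> I\<close> I(1) by blast
      ultimately show "(Y \<union> X) \<inter> (V j \<union> W) = (Y \<union> (X \<inter> {u})) \<inter> (V j \<union> W)" by blast
    qed (use that in \<open>auto simp: P_def\<close>)
    show "(j, c) \<in> out (Y \<union> X) \<longleftrightarrow> (j, c) \<in> out Y"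
      if "j \<in> {1..m} - (\<Union>u\<in>I. P u)" "X \<subseteq> I" for j Y X c
    proof (rule out_dep)
      have "X \<inter> V j = {}" using that by (auto simp: P_def)
      moreover have "X \<inter> W = {}" using \<open>X \<subseteq> I\<close> I(1) by blast
      ultimately show "(Y \<union> X) \<inter> (V j \<union> W) = Y \<inter> (V j \<union> W)" by blast
    qed (use that in auto)
  qed (use I p in \<open>auto simp: P_def\<close>)
  have m_le: "real m \<le> 4 * (real (card I) * (2 * (real D)\<^sup>2 + 1))"
  proof -
    have "card ({..<l} - W) \<ge> l - card W"
      using diff_card_le_card_Diff[OF finW, of "{..<l}"] by simp
    \<comment> \<open>At most m/4 inputs are frozen, so at least 3m/4 remain. Twice this number
      exceeds card {1..m} = m by at least m/2, which the chosen inputs must account for.\<close>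
    then have "m \<le> 4 * (card I * (2 * D\<^sup>2 + 1))"
      using I_card cardW M l by simp
    then have "real m \<le> real (4 * (card I * (2 * D\<^sup>2 + 1)))" by (rule of_nat_mono)
    then show ?thesis by (simp add: algebra_simps)
  qed
  define \<beta> where "\<beta> A = g A ! (2 * m)" for A
  have \<beta>: "\<beta> (Y \<union> X) = \<beta> Y" if "X \<subseteq> I" for Y X
  proof -
    have "X \<inter> S (2 * m) = {}" using that I(1) by (auto simp: W_def)
    then show ?thesis unfolding \<beta>_def by (intro dep) auto
  qed
  define T where "T = {w. encode m w \<in> inert_image R \<union> sparse (R + t)
    \<or> w ! (2 * m) \<noteq> parity_mm p {1..m} (encode m w)}"
  define \<eta> where "\<eta> = (1 / real p + real p * exp (- real t / (8 * (real p)\<^sup>2))) / 2"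
  have "2 ^ l * (1 / 2 - \<eta>) \<le> real (card {A\<in>Pow {..<l}. g A \<in> T})"
    using card_caught_ge[of \<beta> t R] \<beta> unfolding \<eta>_def T_def out_def \<beta>_def by simp
  then have "2 ^ l * (1 / 2 - \<eta>) \<le> real (card {z\<in>bitstrings l. f z \<in> T})"
    by (simp only: card_bitstrings_Collect g_def)
  then have P1: "1 / 2 - \<eta> \<le> measure_pmf.prob (map_pmf f (pmf_of_set (bitstrings l))) T"
    unfolding prob_map_bitstrings by (simp add: field_simps)
  let ?pm = "\<lambda>z. z @ [pmmajmod p (m + 1) z]"
  \<comment> \<open>The target always carries the right last bit, so only the first alternative of
    the test can catch it.\<close>
  have "{z\<in>bitstrings (2 * m). ?pm z \<in> T}
    = {z\<in>bitstrings (2 * m). encode m z \<in> inert_image R \<union> sparse (R + t)}"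
    by (intro Collect_cong conj_cong refl)
      (auto simp: T_def bitstrings_def encode_append pmmajmod_eq_parity_mm[simplified] nth_append)
  then have "card {z\<in>bitstrings (2 * m). ?pm z \<in> T}
    = card {z\<in>bitstrings (2 * m). encode m z \<in> inert_image R \<union> sparse (R + t)}" by simp
  also have "\<dots> \<le> card (inert_image R \<union> sparse (R + t))"
  proof (rule card_inj_on_le[of "encode m"])
    show "finite (inert_image R \<union> sparse (R + t))"
      by (intro finite_UnI finite_inert_image finite_sparse)
  qed (auto intro: inj_on_subset[OF inj_on_encode])
  also have "\<dots> \<le> card (inert_image R) + card (sparse (R + t))" by (rule card_Un_le)
  finally have "real (card {z\<in>bitstrings (2 * m). ?pm z \<in> T})
    \<le> real (card (inert_image R)) + real (card (sparse (R + t)))"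
    by (simp only: of_nat_add[symmetric] of_nat_le_iff)
  also have "real (card (inert_image R)) \<le> 2 ^ (l - R)"
  proof -
    have "card (inert_image R) \<le> 2 ^ (l - R)"
      using card_inert_image_le[of R] by (simp add: inert_image_def)
    then have "real (card (inert_image R)) \<le> real (2 ^ (l - R))" by (rule of_nat_mono)
    then show ?thesis by simp
  qed
  also have "real (card (sparse (R + t)))
    \<le> 2 ^ (2 * m) * (2 ^ (R + t) * exp (- real m / (8 * (2 * (real D)\<^sup>2 + 1) * 2 ^ (4 * D))))"
  proof -
    have pos: "0 < 2 * (real D)\<^sup>2 + 1"
      by (intro add_nonneg_pos) auto
    have "real m / (8 * (2 * (real D)\<^sup>2 + 1) * 2 ^ (4 * D)) \<le> real (card I) / (2 * 2 ^ (4 * D))"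
    proof -
      have "x / (8 * y * z) \<le> c / (2 * z)" if "x \<le> 4 * (c * y)" "0 < y" "0 < z" for x y z c :: real
        using that by (simp add: field_simps)
      from this[OF m_le pos, of "2 ^ (4 * D)"] show ?thesis by (simp only: zero_less_power zero_less_numeral)
    qed
    then have "2 ^ (2 * m) * (2 ^ (R + t) * exp (- real (card I) / (2 * 2 ^ (4 * D))))
      \<le> 2 ^ (2 * m) * (2 ^ (R + t) * exp (- real m / (8 * (2 * (real D)\<^sup>2 + 1) * 2 ^ (4 * D))))"
      by (intro mult_left_mono) auto
    moreover have "real (card (sparse (R + t)))
      \<le> 2 ^ (2 * m) * (2 ^ (R + t) * exp (- real (card I) / (2 * 2 ^ (4 * D))))"
      using card_sparse_le[of "R + t"] by (simp add: mult.assoc)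
    ultimately show ?thesis by (rule order_trans[rotated])
  qed
  finally have "measure_pmf.prob (map_pmf ?pm (pmf_of_set (bitstrings (2 * m)))) T
    \<le> (2 ^ (l - R) + 2 ^ (2 * m) * (2 ^ (R + t) *
        exp (- real m / (8 * (2 * (real D)\<^sup>2 + 1) * 2 ^ (4 * D))))) / 2 ^ (2 * m)"
    unfolding prob_map_bitstrings by (intro divide_right_mono) auto
  also have "\<dots> = 2 ^ (l - R) / 2 ^ (2 * m)
    + 2 ^ (R + t) * exp (- real m / (8 * (2 * (real D)\<^sup>2 + 1) * 2 ^ (4 * D)))"
    by (simp add: add_divide_distrib)
  finally show ?thesis
    using P1 tvd_ge[of "map_pmf f (pmf_of_set (bitstrings l))" T
        "map_pmf ?pm (pmf_of_set (bitstrings (2 * m)))"]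
    unfolding \<eta>_def by linarith
qed

section \<open>Choice of parameters\<close>

lemma real_nat_ceiling_le: "0 \<le> x \<Longrightarrow> real (nat \<lceil>x\<rceil>) \<le> x + 1"
  using ceiling_correct[of x] by simp

text \<open>With locality k = ceil(sqrt y) and k path edges left, a pair (h_j, x_j) reads at most
  k(k + 1) inputs. The square root in the locality keeps this linear in y, hence logarithmic in
  N.\<close>

lemma ceiling_sqrt_power2_le:
  fixes y :: real
  assumes "y \<ge> 4"
  shows "real (nat \<lceil>sqrt y\<rceil>) * (real (nat \<lceil>sqrt y\<rceil>) + 1) \<le> 8 * y"
proof -
  define k where "k = real (nat \<lceil>sqrt y\<rceil>)"
  have k: "0 \<le> k" by (simp add: k_def)
  have "k \<le> sqrt y + 1"
    unfolding k_def by (rule real_nat_ceiling_le) (use assms in simp)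
  moreover have "sqrt y \<ge> 2" using assms by (simp add: real_le_rsqrt)
  ultimately have "k \<le> 2 * sqrt y" "k + 1 \<le> 2 * sqrt y" by linarith+
  then have "k * (k + 1) \<le> (2 * sqrt y) * (2 * sqrt y)"
    using k assms by (intro mult_mono) auto
  also have "\<dots> \<le> 8 * y" using assms by simp
  finally show ?thesis unfolding k_def .
qed

lemma eight_mult_le_power2: "6 \<le> k \<Longrightarrow> 8 * k \<le> (2::nat) ^ k"
  by (induction k rule: nat_induct_at_least) auto

lemma eventually_large:
  fixes \<delta> \<alpha> c1 c2 \<epsilon> :: real
  assumes "0 \<le> \<delta>" "\<delta> < 1" "0 < \<alpha>" "\<alpha> < 1 / 3" "0 < c1" "0 < c2" and \<epsilon>: "\<epsilon> = (1 - \<delta>) / 200"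
  shows "\<forall>\<^sub>F N in at_top. N \<ge> 3 \<and> \<epsilon> * ln N \<ge> 36 \<and> 32 * \<epsilon> * ln N < c1 * N powr \<alpha> \<and> 3 \<le> c1 * N powr \<alpha>
    \<and> ln N \<le> c1 * N powr \<alpha> \<and> c2 * N powr \<alpha> \<le> N \<and> 64 * \<epsilon> * ln N + 1 \<le> N / 2
    \<and> N powr \<delta> + 3 + 2 * ln N + 16 * (c2\<^sup>2 * N powr (2 / 3)) * ln N \<le> N powr (1 - 48 * \<epsilon>) / 16
    \<and> ln N \<le> N"
proof -
  have "\<epsilon> > 0" using assms by simp
  define \<gamma> where "\<gamma> = 1 - 48 * \<epsilon>"
  \<comment> \<open>Here 48 \<epsilon> = 0.24 (1 - \<delta>). The exponent \<gamma> of the available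
    blocks thus exceeds both \<delta>, for the surplus seed length, and 2/3, for p^2 with \<alpha> <
    1/3.\<close>
  have \<gamma>: "\<gamma> > 2 / 3" "\<gamma> > \<delta>" using assms by (auto simp: \<gamma>_def)
  have "\<forall>\<^sub>F N in at_top. (N::real) \<ge> 3" by real_asymp
  moreover have "\<forall>\<^sub>F N in at_top. \<epsilon> * ln N \<ge> 36" using \<open>\<epsilon> > 0\<close> by real_asymp
  moreover have "\<forall>\<^sub>F N in at_top. 32 * \<epsilon> * ln N < c1 * N powr \<alpha>"
    using \<open>\<epsilon> > 0\<close> assms(3,5) by real_asymp
  moreover have "\<forall>\<^sub>F N in at_top. 3 \<le> c1 * N powr \<alpha>" using assms(3,5) by real_asymp
  moreover have "\<forall>\<^sub>F N in at_top. ln N \<le> c1 * N powr \<alpha>" using assms(3,5) by real_asymp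
  moreover have "\<forall>\<^sub>F N in at_top. c2 * N powr \<alpha> \<le> N"
  proof -
    have "\<forall>\<^sub>F N in at_top. c2 * N powr (1 / 3) \<le> N" using assms(6) by real_asymp
    moreover have "\<forall>\<^sub>F N in at_top. (N::real) \<ge> 1" by real_asymp
    ultimately show ?thesis
    proof eventually_elim
      case (elim N)
      have "N powr \<alpha> \<le> N powr (1 / 3)" using elim assms by (intro powr_mono) auto
      then have "c2 * N powr \<alpha> \<le> c2 * N powr (1 / 3)" using assms by (intro mult_left_mono) auto
      then show ?case using elim by linarith
    qed
  qed
  moreover have "\<forall>\<^sub>F N in at_top. 64 * \<epsilon> * ln N + 1 \<le> N / 2" using \<open>\<epsilon> > 0\<close> by real_asymp
  moreover have "\<forall>\<^sub>F N in at_top. N powr \<delta> + 3 + 2 * ln N + 16 * (c2\<^sup>2 * N powr (2 / 3)) * ln N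
    \<le> N powr \<gamma> / 16"
  proof -
    have "\<forall>\<^sub>F N in at_top. N powr \<delta> \<le> N powr \<gamma> / 64" using \<gamma>(2) by real_asymp
    moreover have "\<forall>\<^sub>F N in at_top. 3 + 2 * ln N \<le> N powr \<gamma> / 64" using \<gamma> by real_asymp
    moreover have "\<forall>\<^sub>F N in at_top. 16 * (c2\<^sup>2 * N powr (2 / 3)) * ln N \<le> N powr \<gamma> / 64"
      using \<gamma>(1) assms(6) by real_asymp
    ultimately show ?thesis
    proof eventually_elim
      case (elim N)
      then show ?case using powr_ge_zero[of N \<gamma>] by linarith
    qed
  qed
  moreover have "\<forall>\<^sub>F N in at_top. ln N \<le> (N::real)" by real_asymp
  ultimately show ?thesis unfolding \<gamma>_def by eventually_elim auto
qed

text \<open>Seeds with l < m are settled by counting. For longer ones each of the four error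
  quantities is at most 1/ln N, and the first two enter with weight 1/2, which gives 3/ln N.\<close>

lemma tvd_pmmajmod_ge:
  fixes \<delta> \<alpha> c1 c2 \<epsilon> :: real and m p l :: nat
  defines "N \<equiv> real (2 * m)"
  assumes par: "0 \<le> \<delta>" "0 < \<alpha>" "\<alpha> < 1 / 3" "0 < \<epsilon>"
    and large: "N \<ge> 3" "\<epsilon> * ln N \<ge> 36" "32 * \<epsilon> * ln N < c1 * N powr \<alpha>" "3 \<le> c1 * N powr \<alpha>"
      "ln N \<le> c1 * N powr \<alpha>" "c2 * N powr \<alpha> \<le> N" "64 * \<epsilon> * ln N + 1 \<le> N / 2"
      "N powr \<delta> + 3 + 2 * ln N + 16 * (c2\<^sup>2 * N powr (2 / 3)) * ln N \<le> N powr (1 - 48 * \<epsilon>) / 16"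
      "ln N \<le> N"
    and p: "prime p" "c1 * N powr \<alpha> \<le> real p" "real p \<le> c2 * N powr \<alpha>"
    and l: "real l \<le> N + N powr \<delta>"
    and len: "\<forall>x\<in>bitstrings l. length (f x) = 2 * m + 1"
    and local: "is_local (sqrt (\<epsilon> * ln N)) l (2 * m + 1) f"
  shows "1 / 2 - 3 / ln N \<le> tvd (map_pmf f (pmf_of_set (bitstrings l)))
        (map_pmf (\<lambda>z. z @ [pmmajmod p (m + 1) z]) (pmf_of_set (bitstrings (2 * m))))"
    (is "_ \<le> ?tvd")
proof (cases "l < m")
  case True
  have "(2::real) ^ l / 2 ^ (2 * m) \<le> 1 / 2"
  proof -
    have "(2::real) ^ (l + 1) \<le> 2 ^ (2 * m)" using True by (intro power_increasing) auto
    then show ?thesis by (simp add: field_simps)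
  qed
  moreover have "1 - 2 ^ l / 2 ^ (2 * m) \<le> ?tvd"
    using len by (rule tvd_short_seed_ge)
  moreover have "0 \<le> 3 / ln N" using large(1) by simp
  ultimately show ?thesis by linarith
next
  case False
  have lnN: "ln N > 0" using large(1) by simp
  \<comment> \<open>The integer k is both the locality and the number of bottom path edges kept.
    With R = a + b, a absorbs the surplus N^\<delta> of the seed and b makes the inert image a small
    fraction. The choice of t makes exp(-t/(8p^2)) at most N^(-2), enough to beat the factor p \<le>
    N.\<close>
  define k where "k = nat \<lceil>sqrt (\<epsilon> * ln N)\<rceil>"
  define M where "M = (m + 1) div 2 ^ k"
  define D where "D = k * (k + 1)"
  define a where "a = nat \<lceil>N powr \<delta>\<rceil>"
  define b where "b = nat \<lceil>ln N\<rceil>"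
  define t where "t = nat \<lceil>16 * (real p)\<^sup>2 * ln N\<rceil>"
  have k6: "k \<ge> 6"
  proof -
    have "sqrt 36 \<le> sqrt (\<epsilon> * ln N)" using large(2) by (rule real_sqrt_le_mono)
    moreover have "sqrt 36 = (6::real)" by (rule real_sqrt_unique) auto
    ultimately have "6 \<le> real k" unfolding k_def using real_nat_ceiling_ge[of "sqrt (\<epsilon> * ln N)"] by linarith
    then show ?thesis by simp
  qed
  have kD: "k \<le> D" by (simp add: D_def)
  have D: "real D \<le> 8 * \<epsilon> * ln N"
    using ceiling_sqrt_power2_le[of "\<epsilon> * ln N"] large(2) by (simp add: D_def k_def algebra_simps)
  \<comment> \<open>The quadratic factor is at most e^(2D) and the power of 2 at most e^(4D). With D
    \<le> 8 \<epsilon> ln N the exponent 6D becomes 48 \<epsilon> ln N.\<close>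
  have tail: "8 * (2 * (real D)\<^sup>2 + 1) * 2 ^ (4 * D) \<le> 8 * N powr (48 * \<epsilon>)"
  proof -
    have "2 * (real D)\<^sup>2 + 1 \<le> exp (2 * real D)"
      using exp_lower_Taylor_quadratic[of "2 * real D"] by (simp add: power2_eq_square)
    moreover have "(2::real) ^ (4 * D) \<le> exp (4 * real D)"
    proof -
      have "(2::real) ^ (4 * D) \<le> exp 1 ^ (4 * D)"
        using exp_ge_add_one_self[of 1] by (intro power_mono) auto
      then show ?thesis by (simp flip: exp_of_nat_mult)
    qed
    ultimately have "(2 * (real D)\<^sup>2 + 1) * 2 ^ (4 * D) \<le> exp (2 * real D) * exp (4 * real D)"
      by (intro mult_mono) auto
    also have "\<dots> = exp (6 * real D)" by (simp flip: exp_add)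
    also have "\<dots> \<le> exp (48 * \<epsilon> * ln N)" using D by simp
    also have "\<dots> = N powr (48 * \<epsilon>)" using large(1) by (simp add: powr_def)
    finally show ?thesis unfolding mult.assoc by (rule mult_left_mono) simp
  qed
  have p3: "3 \<le> p" using p(2) large(4) by linarith
  have main: "1 / 2 - (1 / real p + real p * exp (- real t / (8 * (real p)\<^sup>2))) / 2
      - 2 ^ (l - (a + b)) / 2 ^ (2 * m)
      - 2 ^ (a + b + t) * exp (- real m / (8 * (2 * (real D)\<^sup>2 + 1) * 2 ^ (4 * D)))
    \<le> ?tvd"
  proof (rule tvd_local_ge[OF local])
    show "sqrt (\<epsilon> * ln N) \<le> real k" unfolding k_def by (rule real_nat_ceiling_ge)
    show "m + 1 \<le> 2 ^ k * (M + 1)"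
    proof -
      have "m + 1 = 2 ^ k * M + (m + 1) mod 2 ^ k" by (simp add: M_def)
      moreover have "(m + 1) mod 2 ^ k < 2 ^ k" by simp
      ultimately show ?thesis unfolding distrib_left by linarith
    qed
    show "4 * (k * (M + 1)) \<le> m"
    proof -
      have "8 * (k * M) \<le> 2 ^ k * M" using eight_mult_le_power2[OF k6] by simp
      also have "\<dots> \<le> m + 1" by (simp add: M_def)
      finally have "8 * (k * M) \<le> m + 1" .
      \<comment> \<open>Added to 8kM \<le> m + 1 this yields 8k(M + 1) \<le> 2m; the extra 1 offsets
        the one in m + 1.\<close>
      moreover have "8 * real k + 1 \<le> real m" using kD D large(7) by (simp add: N_def)
      then have "8 * k + 1 \<le> m" by linarith
      ultimately show ?thesis by simp
    qed
    have "4 * real D < real p" using D large(3) p(2) by linarith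
    then show "4 * D < p" by linarith
  qed (use False k6 p p3 in \<open>auto simp: D_def\<close>)
  have e1: "1 / real p \<le> 1 / ln N"
    using p(2) large(5) lnN by (intro divide_left_mono mult_pos_pos) auto
  have pos_p: "real p > 0" using p3 by simp
  have inv: "1 / N \<le> 1 / ln N"
    using large(1,9) lnN by (intro divide_left_mono mult_pos_pos) auto
  have e2: "real p * exp (- real t / (8 * (real p)\<^sup>2)) \<le> 1 / ln N"
  proof -
    have "16 * (real p)\<^sup>2 * ln N \<le> real t" unfolding t_def by (rule real_nat_ceiling_ge)
    then have "2 * ln N \<le> real t / (8 * (real p)\<^sup>2)" using pos_p by (simp add: field_simps)
    then have "exp (- real t / (8 * (real p)\<^sup>2)) \<le> exp (- (2 * ln N))" by simp
    also have "\<dots> = 1 / (N * N)"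
      using large(1) by (simp add: exp_minus exp_double power2_eq_square divide_simps)
    finally have "real p * exp (- real t / (8 * (real p)\<^sup>2)) \<le> N * (1 / (N * N))"
      using p(3) large(1,6) by (intro mult_mono) auto
    also have "\<dots> = 1 / N" using large(1) by simp
    finally show ?thesis using inv by linarith
  qed
  have e3: "2 ^ (l - (a + b)) / 2 ^ (2 * m) \<le> 1 / ln N"
  proof -
    have "real l \<le> real (2 * m) + real a"
      using l real_nat_ceiling_ge[of "N powr \<delta>"] unfolding a_def N_def by linarith
    then have "l - (a + b) \<le> 2 * m - b" by linarith
    moreover have bm: "b \<le> 2 * m"
      using large(9) by (simp add: b_def N_def ceiling_le_iff nat_le_iff)
    ultimately have "(2::real) ^ (l - (a + b)) * 2 ^ b \<le> 2 ^ (2 * m - b) * 2 ^ b"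
      by (intro mult_right_mono power_increasing) auto
    also have "\<dots> = 2 ^ (2 * m)" using bm by (simp flip: power_add)
    finally have "2 ^ (l - (a + b)) / 2 ^ (2 * m) \<le> 1 / (2::real) ^ b" by (simp add: field_simps)
    also have "\<dots> \<le> 1 / ln N"
    proof -
      have "ln N \<le> real b" unfolding b_def by (rule real_nat_ceiling_ge)
      also have "\<dots> \<le> 2 ^ b" using of_nat_less_two_power[of b, where ?'a = real] by linarith
      finally show ?thesis using lnN by (intro divide_left_mono) auto
    qed
    finally show ?thesis .
  qed
  have e4: "2 ^ (a + b + t) * exp (- real m / (8 * (2 * (real D)\<^sup>2 + 1) * 2 ^ (4 * D))) \<le> 1 / ln N"
  proof -
    have "(real p)\<^sup>2 \<le> (c2 * N powr \<alpha>)\<^sup>2" using p(3) by (intro power_mono) auto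
    also have "\<dots> = c2\<^sup>2 * N powr (2 * \<alpha>)"
      using large(1) by (simp add: power_mult_distrib powr_realpow[symmetric] powr_powr mult.commute)
    also have "\<dots> \<le> c2\<^sup>2 * N powr (2 / 3)"
      using large(1) par by (intro mult_left_mono powr_mono) auto
    finally have "16 * (real p)\<^sup>2 * ln N \<le> 16 * (c2\<^sup>2 * N powr (2 / 3)) * ln N"
      using lnN by (intro mult_right_mono mult_left_mono) auto
    moreover have "real a \<le> N powr \<delta> + 1" "real b \<le> ln N + 1" "real t \<le> 16 * (real p)\<^sup>2 * ln N + 1"
      unfolding a_def b_def t_def using lnN by (intro real_nat_ceiling_le; simp)+
    \<comment> \<open>The summand ln N is kept in reserve: after 2^(a + b + t) is cancelled, it
      leaves the factor 1/N.\<close>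
    ultimately have "real (a + b + t) + ln N \<le> N powr (1 - 48 * \<epsilon>) / 16"
      using large(8) by simp
    also have "\<dots> = real m / (8 * N powr (48 * \<epsilon>))"
      using large(1) by (simp add: powr_diff N_def)
    also have "\<dots> \<le> real m / (8 * (2 * (real D)\<^sup>2 + 1) * 2 ^ (4 * D))"
      using tail by (intro divide_left_mono mult_pos_pos add_nonneg_pos) (use large(1) in auto)
    finally have "- real m / (8 * (2 * (real D)\<^sup>2 + 1) * 2 ^ (4 * D)) \<le> - real (a + b + t) - ln N"
      by simp
    then have "exp (- real m / (8 * (2 * (real D)\<^sup>2 + 1) * 2 ^ (4 * D)))
      \<le> exp (- real (a + b + t) - ln N)" by (simp only: exp_le_cancel_iff)
    moreover have "(2::real) ^ (a + b + t) \<le> exp (real (a + b + t))"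
    proof -
      have "(2::real) ^ (a + b + t) \<le> exp 1 ^ (a + b + t)"
        using exp_ge_add_one_self[of 1] by (intro power_mono) auto
      then show ?thesis by (simp flip: exp_of_nat_mult)
    qed
    ultimately have "2 ^ (a + b + t) * exp (- real m / (8 * (2 * (real D)\<^sup>2 + 1) * 2 ^ (4 * D)))
      \<le> exp (real (a + b + t)) * exp (- real (a + b + t) - ln N)"
      by (intro mult_mono) auto
    also have "\<dots> = exp (- ln N)" by (simp flip: exp_add)
    also have "\<dots> = 1 / N" using large(1) by (simp add: exp_minus divide_simps)
    finally show ?thesis using inv by linarith
  qed
  have "1 / 2 - 3 * r \<le> T"
    if "1 / 2 - (w + x) / 2 - y - z \<le> T" "w \<le> r" "x \<le> r" "y \<le> r" "z \<le> r"
    for r w x y z T :: real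
    using that by (simp add: field_simps)
  from this[OF main e1 e2 e3 e4] show ?thesis by simp
qed

theorem theorem7p1:
  shows "\<forall>(\<delta>::real) (\<alpha>::real). 0 \<le> \<delta> \<and> \<delta> < 1 \<and> \<delta> / 3 < \<alpha> \<and> \<alpha> < 1 / 3 \<longrightarrow>
    (\<exists>\<epsilon>::real. \<epsilon> > 0 \<and>
      (\<forall>c1 c2 :: real. 0 < c1 \<and> c1 \<le> c2 \<longrightarrow>
        (\<exists>C::real. C > 0 \<and> (\<exists>n0::nat. \<forall>n \<ge> n0.
          \<forall>(p::nat) (l::nat) (f :: bool list \<Rightarrow> bool list).
            let N = 2 * n - 2 in
            prime p \<longrightarrow>
            c1 * real N powr \<alpha> \<le> real p \<longrightarrow> real p \<le> c2 * real N powr \<alpha> \<longrightarrow>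
            real l \<le> real N + real N powr \<delta> \<longrightarrow>
            (\<forall>x \<in> bitstrings l. length (f x) = N + 1) \<longrightarrow>
            is_local (sqrt (\<epsilon> * ln (real N))) l (N + 1) f \<longrightarrow>
            tvd (map_pmf f (pmf_of_set (bitstrings l)))
                (map_pmf (\<lambda>z. z @ [pmmajmod p n z]) (pmf_of_set (bitstrings N)))
              \<ge> 1 / 2 - C / ln (real N)))))"
proof (intro allI impI, elim conjE)
  fix \<delta> \<alpha> :: real
  assume par: "0 \<le> \<delta>" "\<delta> < 1" "\<delta> / 3 < \<alpha>" "\<alpha> < 1 / 3"
  define \<epsilon> where "\<epsilon> = (1 - \<delta>) / 200"
  have \<epsilon>: "\<epsilon> > 0" using par by (simp add: \<epsilon>_def)
  have \<alpha>: "0 < \<alpha>" using par by linarith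
  have "\<exists>C::real. C > 0 \<and> (\<exists>n0::nat. \<forall>n \<ge> n0.
          \<forall>(p::nat) (l::nat) (f :: bool list \<Rightarrow> bool list).
            let N = 2 * n - 2 in
            prime p \<longrightarrow>
            c1 * real N powr \<alpha> \<le> real p \<longrightarrow> real p \<le> c2 * real N powr \<alpha> \<longrightarrow>
            real l \<le> real N + real N powr \<delta> \<longrightarrow>
            (\<forall>x \<in> bitstrings l. length (f x) = N + 1) \<longrightarrow>
            is_local (sqrt (\<epsilon> * ln (real N))) l (N + 1) f \<longrightarrow>
            tvd (map_pmf f (pmf_of_set (bitstrings l)))
                (map_pmf (\<lambda>z. z @ [pmmajmod p n z]) (pmf_of_set (bitstrings N)))
              \<ge> 1 / 2 - C / ln (real N))" if c: "0 < c1" "c1 \<le> c2" for c1 c2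
  proof -
    have "filterlim (\<lambda>n. real (2 * n - 2)) at_top sequentially"
      by (rule filterlim_compose[OF filterlim_real_sequentially])
        (rule filterlim_at_top_mono[OF filterlim_ident], auto intro: eventually_sequentiallyI[of 2])
    from eventually_compose_filterlim
      [OF eventually_large[OF par(1,2) \<alpha> par(4) c(1) _ \<epsilon>_def] this, of c2]
    obtain n0 where n0: "\<And>n. n \<ge> n0 \<Longrightarrow> real (2 * n - 2) \<ge> 3 \<and> \<epsilon> * ln (real (2 * n - 2)) \<ge> 36
      \<and> 32 * \<epsilon> * ln (real (2 * n - 2)) < c1 * real (2 * n - 2) powr \<alpha>
      \<and> 3 \<le> c1 * real (2 * n - 2) powr \<alpha>
      \<and> ln (real (2 * n - 2)) \<le> c1 * real (2 * n - 2) powr \<alpha>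
      \<and> c2 * real (2 * n - 2) powr \<alpha> \<le> real (2 * n - 2)
      \<and> 64 * \<epsilon> * ln (real (2 * n - 2)) + 1 \<le> real (2 * n - 2) / 2
      \<and> real (2 * n - 2) powr \<delta> + 3 + 2 * ln (real (2 * n - 2))
          + 16 * (c2\<^sup>2 * real (2 * n - 2) powr (2 / 3)) * ln (real (2 * n - 2))
        \<le> real (2 * n - 2) powr (1 - 48 * \<epsilon>) / 16
      \<and> ln (real (2 * n - 2)) \<le> real (2 * n - 2)"
      using c unfolding eventually_sequentially by auto
    show ?thesis
      unfolding Let_def
    proof (intro exI[of _ "3::real"] conjI exI[of _ n0] allI impI)
      fix n p l :: nat and f :: "bool list \<Rightarrow> bool list"
      let ?N = "2 * n - 2"
      assume n: "n \<ge> n0" and p: "prime p" "c1 * real ?N powr \<alpha> \<le> real p"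
        "real p \<le> c2 * real ?N powr \<alpha>"
        and l: "real l \<le> real ?N + real ?N powr \<delta>"
        and len: "\<forall>x\<in>bitstrings l. length (f x) = ?N + 1"
        and local: "is_local (sqrt (\<epsilon> * ln (real ?N))) l (?N + 1) f"
      \<comment> \<open>For n = 0 the truncated N would be 0, against N \<ge> 3. So n - 1 is a
        genuine predecessor and can serve as m.\<close>
      have "n \<ge> 1" using n0[OF n] by (cases n) auto
      then have n_eq: "n - 1 + 1 = n" "?N = 2 * (n - 1)" by auto
      show "1 / 2 - 3 / ln (real ?N) \<le> tvd (map_pmf f (pmf_of_set (bitstrings l)))
          (map_pmf (\<lambda>z. z @ [pmmajmod p n z]) (pmf_of_set (bitstrings ?N)))"
        using tvd_pmmajmod_ge[of \<delta> \<alpha> \<epsilon> "n - 1" c1 c2 p l f] n0[OF n] p l len local par \<alpha> \<epsilon>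
        unfolding n_eq by blast
    qed simp
  qed
  then show "\<exists>\<epsilon>::real. \<epsilon> > 0 \<and>
      (\<forall>c1 c2 :: real. 0 < c1 \<and> c1 \<le> c2 \<longrightarrow>
        (\<exists>C::real. C > 0 \<and> (\<exists>n0::nat. \<forall>n \<ge> n0.
          \<forall>(p::nat) (l::nat) (f :: bool list \<Rightarrow> bool list).
            let N = 2 * n - 2 in
            prime p \<longrightarrow>
            c1 * real N powr \<alpha> \<le> real p \<longrightarrow> real p \<le> c2 * real N powr \<alpha> \<longrightarrow>
            real l \<le> real N + real N powr \<delta> \<longrightarrow>
            (\<forall>x \<in> bitstrings l. length (f x) = N + 1) \<longrightarrow>
            is_local (sqrt (\<epsilon> * ln (real N))) l (N + 1) f \<longrightarrow>
            tvd (map_pmf f (pmf_of_set (bitstrings l)))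
                (map_pmf (\<lambda>z. z @ [pmmajmod p n z]) (pmf_of_set (bitstrings N)))
              \<ge> 1 / 2 - C / ln (real N))))"
    using \<epsilon> by blast
qed

end
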